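(* Let $\Omega$ be a convex future complete domain in $\mathbf{R}^{1,n}$ containing no lightlike line, and let $\tau$ be its cosmological time function. Then $$\hat d_{\ln(\tau)}\le\delta_\Omega\le 2\,\hat d_{\ln(\tau)}\quad\text{on }\Omega\times\Omega.$$ In addition, the equality $\hat d_{\ln(\tau)}=\delta_\Omega$ holds (on all of $\Omega\times\Omega$) if and only if $\Omega$ is the future of a spacelike hyperplane, and the equality $\delta_\Omega=2\hat d_{\ln(\tau)}$ holds (on all of $\Omega\times\Omega$) if and only if $\Omega$ is the future of a point.
   Context: Minkowski space: $\mathbf{R}^{1,n}$ ($n\ge 1$) is $\mathbf{R}\times\mathbf{R}^n$ with coordinates $(t,p)$, flat metric $\mathbf{b}=-dt^2+dp_1^2+\dots+dp_n^2$ and time orientation $\partial_t$. A nonzero vector $v$ is timelike, lightlike, spacelike if $\mathbf{b}(v,v)$ is $<0$, $=0$, $>0$, causal if $\mathbf{b}(v,v)\le 0$, and a causal vector is future if $\mathbf{b}(v,\partial_t)<0$; a future causal (timelike) curve is a piecewise smooth curve with future causal (timelike) velocity. Write $x\le y$ if $x=y$ or there is a future causal curve from $x$ to $y$; $J^-(x)=\{y:y\le x\}$. The future $I^+(A)$ of a set $A$ is the set of points reached from points of $A$ by future timelike curves. A hyperplane is spacelike if $\mathbf{b}$ is positive definite on its direction. A domain is a nonempty, connected, proper open subset of $\mathbf{R}^{1,n}$. A domain $\Omega$ is future complete if every future causal curve of $\mathbf{R}^{1,n}$ starting in $\Omega$ is contained in $\Omega$. A lightlike line is a complete affine line with lightlike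 direction. Cosmological time: for $x\le y$ let $\mathcal{T}(x,y)=\sqrt{|\mathbf{b}(y-x,y-x)|}$; $\tau(x)=\sup\{\mathcal{T}(y,x): y\in\Omega\cap J^-(x)\}$. Null distance: for a time function $T:\Omega\to\mathbf{R}$ (continuous and strictly increasing along future causal curves), $\hat d_T(x,y)=\inf\sum_{k=1}^{m-1}|T(x_{k+1})-T(x_k)|$, the infimum over all finite sequences $x_1=x,\dots,x_m=y$ in $\Omega$ such that $x_k$ and $x_{k+1}$ are causally related for all $k$. Markowitz pseudodistance: let $I=(-1,1)$ and $\rho_I(s,t)=\left|\ln\frac{(s-1)(t+1)}{(s+1)(t-1)}\right|$. For a domain $\Omega$, a projectively parametrized lightlike geodesic of $\Omega$ is a curve $\gamma:I\to\Omega$, $\gamma(s)=x+h(s)v$, with $v$ lightlike and $h$ a (nonconstant) real homography without pole in $I$. Then $\delta_\Omega(x,y)=\inf\sum_{k=1}^m\rho_I(s_k,t_k)$, the infimum being over all finite families of such geodesics $\gamma_1,\dots,\gamma_m$ and points $s_k,t_k\in I$ with $\gamma_1(s_1)=x$, $\gamma_m(t_m)=y$, $\gamma_k(t_k)=\gamma_{k+1}(s_{k+1})$. *)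

theory Defs
  imports "HOL-Analysis.Analysis"
begin

type_synonym 'n minkowski = "real \<times> (real, 'n) vec"

definition mink :: "'n::finite minkowski \<Rightarrow> 'n minkowski \<Rightarrow> real" where
  "mink v w = - fst v * fst w + snd v \<bullet> snd w"

definition time_vector :: "'n::finite minkowski" where
  "time_vector = (1, 0)"

definition timelike :: "'n::finite minkowski \<Rightarrow> bool" where
  "timelike v \<longleftrightarrow> v \<noteq> 0 \<and> mink v v < 0"

definition lightlike :: "'n::finite minkowski \<Rightarrow> bool" where
  "lightlike v \<longleftrightarrow> v \<noteq> 0 \<and> mink v v = 0"

definition causal :: "'n::finite minkowski \<Rightarrow> bool" where
  "causal v \<longleftrightarrow> v \<noteq> 0 \<and> mink v v \<le> 0"

definition future_causal :: "'n::finite minkowski \<Rightarrow> bool" where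
  "future_causal v \<longleftrightarrow> causal v \<and> mink v time_vector < 0"

definition future_timelike :: "'n::finite minkowski \<Rightarrow> bool" where
  "future_timelike v \<longleftrightarrow> timelike v \<and> mink v time_vector < 0"

text \<open>Infinite differentiability on a compact interval, one-sided at the endpoints;
  \<open>D k\<close> is the derivative of order \<open>k\<close>.\<close>

definition smooth_on_segment :: "real \<Rightarrow> real \<Rightarrow> (real \<Rightarrow> 'a::real_normed_vector) \<Rightarrow> bool" where
  "smooth_on_segment a b \<gamma> \<longleftrightarrow>
     (\<exists>D :: nat \<Rightarrow> real \<Rightarrow> 'a.
        (\<forall>t\<in>{a..b}. D 0 t = \<gamma> t) \<and>
        (\<forall>k. \<forall>t\<in>{a..b}. (D k has_vector_derivative D (Suc k) t) (at t within {a..b})))"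

text \<open>The velocity condition is imposed on each closed piece, hence on both one-sided
  velocities at a break point. Continuity on \<open>{a..b}\<close> is implied, as the pieces are closed.\<close>

definition piecewise_smooth_curve_with_velocity ::
  "('a::real_normed_vector \<Rightarrow> bool) \<Rightarrow> real \<Rightarrow> real \<Rightarrow> (real \<Rightarrow> 'a) \<Rightarrow> bool" where
  "piecewise_smooth_curve_with_velocity P a b \<gamma> \<longleftrightarrow>
     (\<exists>(N::nat) (p :: nat \<Rightarrow> real). 1 \<le> N \<and> p 0 = a \<and> p N = b \<and>
        (\<forall>i<N. p i < p (Suc i) \<and>
               smooth_on_segment (p i) (p (Suc i)) \<gamma> \<and>
               (\<forall>t\<in>{p i..p (Suc i)}.
                  P (vector_derivative \<gamma> (at t within {p i..p (Suc i)})))))"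

definition future_causal_curve :: "real \<Rightarrow> real \<Rightarrow> (real \<Rightarrow> 'n::finite minkowski) \<Rightarrow> bool" where
  "future_causal_curve a b \<gamma> \<longleftrightarrow> piecewise_smooth_curve_with_velocity future_causal a b \<gamma>"

definition future_timelike_curve :: "real \<Rightarrow> real \<Rightarrow> (real \<Rightarrow> 'n::finite minkowski) \<Rightarrow> bool" where
  "future_timelike_curve a b \<gamma> \<longleftrightarrow> piecewise_smooth_curve_with_velocity future_timelike a b \<gamma>"

definition causal_le :: "'n::finite minkowski \<Rightarrow> 'n minkowski \<Rightarrow> bool" where
  "causal_le x y \<longleftrightarrow> x = y \<or> (\<exists>a b \<gamma>. future_causal_curve a b \<gamma> \<and> \<gamma> a = x \<and> \<gamma> b = y)"

definition causal_past :: "'n::finite minkowski \<Rightarrow> 'n minkowski set" where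
  "causal_past x = {y. causal_le y x}"

definition chronological_future :: "'n::finite minkowski set \<Rightarrow> 'n minkowski set" where
  "chronological_future A =
     {y. \<exists>x\<in>A. \<exists>a b \<gamma>. future_timelike_curve a b \<gamma> \<and> \<gamma> a = x \<and> \<gamma> b = y}"

definition spacelike_hyperplane :: "'n::finite minkowski set \<Rightarrow> bool" where
  "spacelike_hyperplane H \<longleftrightarrow>
     affine H \<and> aff_dim H = int DIM('n minkowski) - 1 \<and>
     (\<forall>v\<in>{y - x |x y. x \<in> H \<and> y \<in> H}. v \<noteq> 0 \<longrightarrow> mink v v > 0)"

definition minkowski_domain :: "'n::finite minkowski set \<Rightarrow> bool" where
  "minkowski_domain \<Omega> \<longleftrightarrow> \<Omega> \<noteq> {} \<and> connected \<Omega> \<and> \<Omega> \<noteq> UNIV \<and> open \<Omega>"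

definition future_complete :: "'n::finite minkowski set \<Rightarrow> bool" where
  "future_complete \<Omega> \<longleftrightarrow>
     (\<forall>a b \<gamma>. future_causal_curve a b \<gamma> \<and> \<gamma> a \<in> \<Omega> \<longrightarrow> \<gamma> ` {a..b} \<subseteq> \<Omega>)"

definition lightlike_line :: "'n::finite minkowski set \<Rightarrow> bool" where
  "lightlike_line L \<longleftrightarrow> (\<exists>x v. lightlike v \<and> L = {x + r *\<^sub>R v |r. r \<in> UNIV})"

definition lorentz_time :: "'n::finite minkowski \<Rightarrow> 'n minkowski \<Rightarrow> real" where
  "lorentz_time x y = sqrt \<bar>mink (y - x) (y - x)\<bar>"

text \<open>For a convex future complete domain without lightlike lines, the supremum below
  is taken over a bounded set, so it is the genuine (finite) supremum.\<close>

definition cosmological_time :: "'n::finite minkowski set \<Rightarrow> 'n minkowski \<Rightarrow> real" where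
  "cosmological_time \<Omega> x = (SUP y\<in>\<Omega> \<inter> causal_past x. lorentz_time y x)"

definition causally_related :: "'n::finite minkowski \<Rightarrow> 'n minkowski \<Rightarrow> bool" where
  "causally_related x y \<longleftrightarrow> causal_le x y \<or> causal_le y x"

text \<open>Any two points of a domain are joined by a chain of the kind considered in each of
  the two infima below, so these are never taken over the empty set.\<close>

definition null_distance ::
  "'n::finite minkowski set \<Rightarrow> ('n minkowski \<Rightarrow> real) \<Rightarrow> 'n minkowski \<Rightarrow> 'n minkowski \<Rightarrow> real" where
  "null_distance \<Omega> T x y =
     Inf {\<Sum>k=1..<m. \<bar>T (z (Suc k)) - T (z k)\<bar> |(m::nat) (z :: nat \<Rightarrow> 'n minkowski).
            1 \<le> m \<and> z 1 = x \<and> z m = y \<and> (\<forall>k\<in>{1..m}. z k \<in> \<Omega>) \<and>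
            (\<forall>k\<in>{1..<m}. causally_related (z k) (z (Suc k)))}"

definition rho_I :: "real \<Rightarrow> real \<Rightarrow> real" where
  "rho_I s t = \<bar>ln (((s - 1) * (t + 1)) / ((s + 1) * (t - 1)))\<bar>"

text \<open>Only the values of \<open>\<gamma>\<close> on \<open>{-1<..<1}\<close> matter; the homography is
  \<open>s \<mapsto> (a s + b) / (c s + d)\<close>, nonconstant iff \<open>a d - b c \<noteq> 0\<close>.\<close>

definition projective_lightlike_geodesic ::
  "'n::finite minkowski set \<Rightarrow> (real \<Rightarrow> 'n minkowski) \<Rightarrow> bool" where
  "projective_lightlike_geodesic \<Omega> \<gamma> \<longleftrightarrow>
     (\<exists>x v a b c d. lightlike v \<and> a * d - b * c \<noteq> 0 \<and>
        (\<forall>s\<in>{-1<..<1}. c * s + d \<noteq> 0 \<and>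
            \<gamma> s = x + ((a * s + b) / (c * s + d)) *\<^sub>R v \<and> \<gamma> s \<in> \<Omega>))"

definition markowitz_distance ::
  "'n::finite minkowski set \<Rightarrow> 'n minkowski \<Rightarrow> 'n minkowski \<Rightarrow> real" where
  "markowitz_distance \<Omega> x y =
     Inf {\<Sum>k=1..m. rho_I (s k) (t k) |
            (m::nat) (\<gamma> :: nat \<Rightarrow> real \<Rightarrow> 'n minkowski) (s :: nat \<Rightarrow> real) (t :: nat \<Rightarrow> real).
            1 \<le> m \<and>
            (\<forall>k\<in>{1..m}. projective_lightlike_geodesic \<Omega> (\<gamma> k) \<and>
                        s k \<in> {-1<..<1} \<and> t k \<in> {-1<..<1}) \<and>
            \<gamma> 1 (s 1) = x \<and> \<gamma> m (t m) = y \<and>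
            (\<forall>k\<in>{1..<m}. \<gamma> k (t k) = \<gamma> (Suc k) (s (Suc k)))}"

end

theory Submission
  imports Defs
begin

text \<open>
  A maximal light ray of the domain is a half-line, so along it the Markowitz pseudodistance is at
  most \<open>ln\<close> of the ratio of the affine distances to its past end. A homothety centred near that past
  end shows that \<open>ln \<circ> \<tau>\<close> varies by at most this amount, which bounds the null distance of \<open>ln \<circ> \<tau>\<close>
  by the Markowitz pseudodistance. Conversely, let \<open>r\<close> be a point of the closure realising \<open>\<tau> x\<close>. The
  domain contains the chronological future of \<open>r\<close>, where the square of the Lorentzian distance to \<open>r\<close> is
  affine along light rays; splitting a causal displacement from \<open>x\<close> into two lightlike ones gives the
  factor 2.

  If the Markowitz pseudodistance is twice the null distance, then every past light ray from \<open>x\<close> leaves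
  the domain on the future light cone of \<open>r\<close> at the latest, and convexity forces the domain to be the
  chronological future of \<open>r\<close>. If the two distances agree, a supporting hyperplane at the past end of
  a light ray shows that \<open>\<tau>\<close> is affine along light rays and vanishes at their past ends. Comparing with
  the distance to \<open>r\<close>, \<open>\<tau>\<close> agrees on the causal future of \<open>x\<close> with the height above the hyperplane
  through \<open>r\<close> orthogonal to \<open>x - r\<close>; the feet of these points lie in the closure of the domain and
  fill the hyperplane.
\<close>

section \<open>Cones in Minkowski space and causal curves\<close>

text \<open>Both distances are infima over chains, so upper bounds come from explicit short chains
  and lower bounds from functions: if \<open>ln \<circ> F\<close> varies along every projectively
  parametrized light ray by at most \<open>rho_I\<close>, then its increment bounds every chain from
  below. The star-shaped inequality of \<open>lightlike_star_function\<close> is the form of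
  concavity that makes this work, and it is applied to three functions: \<open>tau\<close>, for the
  general inequality; the squared distance to the vertex, for the future of a point; and a
  supporting linear functional, which yields the exact Markowitz pseudodistance along a light ray.
  The factor 2 is the exponent in the second case: there the square of \<open>tau\<close> is affine
  along light rays, whereas above a hyperplane \<open>tau\<close> itself is. On a causal pair the
  null distance is just the increment of \<open>ln \<circ> tau\<close>, so each equality assumption
  becomes a statement about \<open>tau\<close> on single light rays. No formula or derivative for
  \<open>tau\<close> is available in general; it is controlled by comparison with the Lorentzian
  distance to one fixed boundary point, which touches \<open>tau\<close> from below.\<close>

definition causal_cone :: "'n::finite minkowski set" where
  "causal_cone = {v. norm (snd v) \<le> fst v}"

definition chron_cone :: "'n::finite minkowski set" where
  "chron_cone = {v. norm (snd v) < fst v}"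

definition lorentz_norm :: "'n::finite minkowski \<Rightarrow> real" where
  "lorentz_norm v = sqrt \<bar>mink v v\<bar>"

section \<open>The Lorentzian form on the causal cones\<close>

lemma mink_commute: "mink v w = mink w v"
  by (simp add: mink_def inner_commute)

lemma mink_algebra:
  "mink (u + v) w = mink u w + mink v w"
  "mink (u - v) w = mink u w - mink v w"
  "mink w (u + v) = mink w u + mink w v"
  "mink w (u - v) = mink w u - mink w v"
  "mink (c *\<^sub>R u) w = c * mink u w"
  "mink w (c *\<^sub>R u) = c * mink w u"
  "mink (- u) w = - mink u w"
  "mink w (- u) = - mink w u"
  "mink 0 w = 0"
  "mink w 0 = 0"
  by (auto simp: mink_def algebra_simps inner_simps)

lemma continuous_on_mink [continuous_intros]:
  "continuous_on S f \<Longrightarrow> continuous_on S g \<Longrightarrow> continuous_on S (\<lambda>x. mink (f x) (g x))"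
  unfolding mink_def by (intro continuous_intros)

lemma continuous_on_lorentz_norm [continuous_intros]:
  "continuous_on S f \<Longrightarrow> continuous_on S (\<lambda>x. lorentz_norm (f x))"
  unfolding lorentz_norm_def by (intro continuous_intros)

lemma mink_self: "mink v v = (norm (snd v))\<^sup>2 - (fst v)\<^sup>2"
  by (simp add: mink_def power2_eq_square flip: power2_norm_eq_inner)

lemma mink_add_self: "mink (z + s *\<^sub>R u) (z + s *\<^sub>R u) = mink z z + 2 * s * mink z u + s\<^sup>2 * mink u u"
  by (simp add: mink_def inner_simps inner_commute power2_eq_square algebra_simps)

lemma mink_diff_self: "mink (z - s *\<^sub>R u) (z - s *\<^sub>R u) = mink z z - 2 * s * mink z u + s\<^sup>2 * mink u u"
  using mink_add_self[of z "- s" u] by simp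

lemma chron_cone_subset_causal_cone: "v \<in> chron_cone \<Longrightarrow> v \<in> causal_cone"
  by (simp add: chron_cone_def causal_cone_def)

lemma causal_cone_fst_nonneg: "v \<in> causal_cone \<Longrightarrow> 0 \<le> fst v"
  unfolding causal_cone_def using order_trans[OF norm_ge_zero] by blast

lemma zero_in_causal_cone [simp]: "0 \<in> causal_cone"
  by (simp add: causal_cone_def)

lemma causal_cone_scaleR: "v \<in> causal_cone \<Longrightarrow> 0 \<le> c \<Longrightarrow> c *\<^sub>R v \<in> causal_cone"
  by (simp add: causal_cone_def mult_left_mono)

lemma chron_cone_scaleR: "v \<in> chron_cone \<Longrightarrow> 0 < c \<Longrightarrow> c *\<^sub>R v \<in> chron_cone"
  by (simp add: chron_cone_def)

lemma causal_cone_add: "v \<in> causal_cone \<Longrightarrow> w \<in> causal_cone \<Longrightarrow> v + w \<in> causal_cone"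
  unfolding causal_cone_def using norm_triangle_ineq[of "snd v" "snd w"] by simp

lemma chron_cone_add: "v \<in> chron_cone \<Longrightarrow> w \<in> causal_cone \<Longrightarrow> v + w \<in> chron_cone"
  unfolding causal_cone_def chron_cone_def using norm_triangle_ineq[of "snd v" "snd w"] by simp

lemma open_chron_cone: "open (chron_cone :: 'n::finite minkowski set)"
  unfolding chron_cone_def by (intro open_Collect_less continuous_intros)

lemma closed_causal_cone: "closed (causal_cone :: 'n::finite minkowski set)"
  unfolding causal_cone_def by (intro closed_Collect_le continuous_intros)

lemma time_vector_in_chron_cone: "time_vector \<in> chron_cone"
  by (simp add: time_vector_def chron_cone_def)

text \<open>The slack \<open>fst w - norm (snd w)\<close> is multiplied by \<open>s\<close> and
  eventually outweighs any fixed \<open>a\<close>. This provides common futures of two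
  points.\<close>

lemma chron_cone_absorbs:
  fixes a w :: "'n::finite minkowski"
  assumes "w \<in> chron_cone"
  obtains s0 where "s0 > 0" "\<And>s. s \<ge> s0 \<Longrightarrow> a + s *\<^sub>R w \<in> chron_cone"
proof -
  define d where "d = fst w - norm (snd w)"
  have d: "d > 0" using assms by (simp add: d_def chron_cone_def)
  define s0 where "s0 = (norm (snd a) + \<bar>fst a\<bar> + 1) / d"
  show thesis
  proof (rule that)
    show "s0 > 0" unfolding s0_def using d by (intro divide_pos_pos) (auto intro: add_nonneg_pos)
    fix s assume s: "s \<ge> s0"
    then have s1: "s * d \<ge> norm (snd a) + \<bar>fst a\<bar> + 1"
      using d by (simp add: s0_def pos_divide_le_eq)
    have "s > 0" using s \<open>s0 > 0\<close> by simp
    then have "norm (snd a + s *\<^sub>R snd w) \<le> norm (snd a) + s * norm (snd w)"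
      using norm_triangle_ineq[of "snd a" "s *\<^sub>R snd w"] by simp
    then show "a + s *\<^sub>R w \<in> chron_cone"
      using s1 by (simp add: chron_cone_def d_def algebra_simps)
  qed
qed

lemma causal_cone_mink_nonpos: "v \<in> causal_cone \<Longrightarrow> mink v v \<le> 0"
  unfolding causal_cone_def mink_self by (simp add: power_mono)

lemma chron_cone_mink_neg: "v \<in> chron_cone \<Longrightarrow> mink v v < 0"
  unfolding chron_cone_def mink_self by (simp add: power_strict_mono)

lemma lorentz_norm_eq: "v \<in> causal_cone \<Longrightarrow> lorentz_norm v = sqrt (- mink v v)"
  using causal_cone_mink_nonpos[of v] by (simp add: lorentz_norm_def)

lemma lorentz_norm_sq: "v \<in> causal_cone \<Longrightarrow> (lorentz_norm v)\<^sup>2 = - mink v v"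
  using causal_cone_mink_nonpos[of v] by (simp add: lorentz_norm_eq)

lemma lorentz_norm_nonneg [simp]: "0 \<le> lorentz_norm v"
  by (simp add: lorentz_norm_def)

lemma lorentz_norm_scaleR: "0 \<le> c \<Longrightarrow> lorentz_norm (c *\<^sub>R v) = c * lorentz_norm v"
  by (simp add: lorentz_norm_def mink_algebra abs_mult real_sqrt_mult power2_eq_square[symmetric])

lemma lorentz_norm_pos: "v \<in> chron_cone \<Longrightarrow> 0 < lorentz_norm v"
  using chron_cone_mink_neg[of v] by (simp add: lorentz_norm_def)

lemma mink_normalize:
  assumes M: "M \<in> chron_cone"
  shows "mink ((1 / lorentz_norm M) *\<^sub>R M) ((1 / lorentz_norm M) *\<^sub>R M) = -1"
proof -
  have "mink M M = - (lorentz_norm M)\<^sup>2"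
    using lorentz_norm_sq[OF chron_cone_subset_causal_cone[OF M]] by simp
  then show ?thesis
    using lorentz_norm_pos[OF M] unfolding mink_algebra(5,6) by (simp add: power2_eq_square)
qed

lemma lorentz_norm_pos_imp_chron:
  assumes "v \<in> causal_cone" "0 < lorentz_norm v"
  shows "v \<in> chron_cone"
proof -
  have "norm (snd v) \<noteq> fst v"
    using assms(2) by (auto simp: lorentz_norm_def mink_self)
  then show ?thesis using assms(1) by (simp add: causal_cone_def chron_cone_def)
qed

lemma mink_causal_nonpos:
  assumes "v \<in> causal_cone" "w \<in> causal_cone"
  shows "mink v w \<le> 0"
proof -
  have "snd v \<bullet> snd w \<le> norm (snd v) * norm (snd w)" by (rule norm_cauchy_schwarz)
  also have "\<dots> \<le> fst v * fst w"
    using assms causal_cone_fst_nonneg by (intro mult_mono) (auto simp: causal_cone_def)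
  finally show ?thesis by (simp add: mink_def)
qed

lemma mink_chron_neg:
  assumes "v \<in> chron_cone" "w \<in> causal_cone" "w \<noteq> 0"
  shows "mink v w < 0"
proof -
  have "fst w > 0"
    using assms(2,3) causal_cone_fst_nonneg[OF assms(2)]
    by (auto simp: causal_cone_def prod_eq_iff order.strict_iff_order)
  have "snd v \<bullet> snd w \<le> norm (snd v) * norm (snd w)" by (rule norm_cauchy_schwarz)
  also have "\<dots> \<le> norm (snd v) * fst w"
    using assms by (intro mult_left_mono) (auto simp: causal_cone_def)
  also have "\<dots> < fst v * fst w"
    using assms(1) \<open>fst w > 0\<close> by (simp add: chron_cone_def)
  finally show ?thesis by (simp add: mink_def)
qed

lemma lorentz_norm_mono:
  assumes "v \<in> causal_cone" "w \<in> causal_cone"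
  shows "lorentz_norm v \<le> lorentz_norm (v + w)"
proof -
  have "- mink v v \<le> - mink (v + w) (v + w)"
    using mink_causal_nonpos[OF assms] causal_cone_mink_nonpos[OF assms(2)]
    by (simp add: mink_algebra mink_commute[of w v])
  then show ?thesis
    using assms causal_cone_add[OF assms] by (simp add: lorentz_norm_eq)
qed

text \<open>Orthogonality writes \<open>fst w * fst N\<close> as a spatial inner product;
  Cauchy-Schwarz and the strict cone inequality for \<open>N\<close> then make the spatial part of
  \<open>w\<close> dominate.\<close>

lemma mink_pos_of_orthogonal_chron:
  assumes N: "N \<in> chron_cone" and orth: "mink w N = 0" and "w \<noteq> 0"
  shows "mink w w > 0"
proof -
  have "fst w * fst N = snd w \<bullet> snd N" using orth by (simp add: mink_def)
  then have "\<bar>fst w\<bar> * fst N \<le> norm (snd w) * norm (snd N)"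
    using Cauchy_Schwarz_ineq2[of "snd w" "snd N"] causal_cone_fst_nonneg[OF chron_cone_subset_causal_cone[OF N]]
    by (metis abs_mult abs_of_nonneg)
  moreover have "norm (snd N) < fst N" using N by (simp add: chron_cone_def)
  moreover have "snd w \<noteq> 0"
  proof
    assume "snd w = 0"
    then have "fst w = 0" using orth \<open>norm (snd N) < fst N\<close> by (auto simp: mink_def)
    with \<open>snd w = 0\<close> \<open>w \<noteq> 0\<close> show False by (simp add: prod_eq_iff)
  qed
  then have "norm (snd w) * norm (snd N) < norm (snd w) * fst N"
    using \<open>norm (snd N) < fst N\<close> by simp
  ultimately have "\<bar>fst w\<bar> * fst N < norm (snd w) * fst N" by linarith
  moreover have "fst N > 0" using \<open>norm (snd N) < fst N\<close> norm_ge_zero[of "snd N"] by linarith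
  ultimately have "\<bar>fst w\<bar> < norm (snd w)" by simp
  then have "(fst w)\<^sup>2 < (norm (snd w))\<^sup>2"
    using power_strict_mono[of "\<bar>fst w\<bar>" "norm (snd w)" 2] by simp
  then show ?thesis by (simp add: mink_self)
qed

text \<open>Split off the component of \<open>z\<close> along \<open>N\<close>: the orthogonal rest
  \<open>w\<close> is spacelike or zero, so it can only shorten \<open>z\<close>, and does so
  strictly unless it vanishes.\<close>

lemma reverse_cauchy_schwarz:
  assumes N: "N \<in> chron_cone" "mink N N = -1" and z: "z \<in> causal_cone"
  shows "lorentz_norm z \<le> - mink z N"
    and "lorentz_norm z = - mink z N \<Longrightarrow> z = lorentz_norm z *\<^sub>R N"
proof -
  define c where "c = - mink z N"
  define w where "w = z - c *\<^sub>R N"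
  have c: "c \<ge> 0"
    using mink_causal_nonpos[OF z chron_cone_subset_causal_cone[OF N(1)]] by (simp add: c_def)
  have w: "mink w N = 0" using N(2) by (simp add: w_def mink_algebra c_def)
  have z_eq: "z = c *\<^sub>R N + w" by (simp add: w_def)
  have q: "mink z z = - c\<^sup>2 + mink w w"
    unfolding z_eq using w N(2) by (simp add: mink_algebra mink_commute[of N w] power2_eq_square)
  have w0: "mink w w \<ge> 0"
    using mink_pos_of_orthogonal_chron[OF N(1) w] by (cases "w = 0") (auto simp: mink_algebra)
  have sq: "(lorentz_norm z)\<^sup>2 = c\<^sup>2 - mink w w" using lorentz_norm_sq[OF z] q by simp
  then have "(lorentz_norm z)\<^sup>2 \<le> c\<^sup>2" using w0 by simp
  then show "lorentz_norm z \<le> - mink z N" using c unfolding c_def[symmetric] by (rule power2_le_imp_le)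
  assume "lorentz_norm z = - mink z N"
  then have "mink w w = 0" using sq by (simp add: c_def)
  then have "w = 0" using mink_pos_of_orthogonal_chron[OF N(1) w] by force
  then show "z = lorentz_norm z *\<^sub>R N"
    using z_eq \<open>lorentz_norm z = - mink z N\<close> by (simp add: c_def)
qed

section \<open>From causal curves to displacements in the cones\<close>

lemma future_causal_iff: "future_causal v \<longleftrightarrow> v \<in> causal_cone \<and> v \<noteq> 0"
proof -
  have "(norm (snd v))\<^sup>2 \<le> (fst v)\<^sup>2 \<and> fst v > 0 \<longleftrightarrow> norm (snd v) \<le> fst v \<and> v \<noteq> 0" if "v \<noteq> 0"
  proof -
    show ?thesis
    proof
      assume "(norm (snd v))\<^sup>2 \<le> (fst v)\<^sup>2 \<and> fst v > 0"
      then show "norm (snd v) \<le> fst v \<and> v \<noteq> 0" using that by (auto intro: power2_le_imp_le)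
    next
      assume "norm (snd v) \<le> fst v \<and> v \<noteq> 0"
      moreover from this have "fst v \<noteq> 0" by (auto simp: prod_eq_iff)
      moreover from calculation have "0 \<le> fst v" using order_trans[OF norm_ge_zero] by blast
      ultimately show "(norm (snd v))\<^sup>2 \<le> (fst v)\<^sup>2 \<and> fst v > 0"
        by (auto intro: power_mono)
    qed
  qed
  then show ?thesis
    by (auto simp: future_causal_def causal_def causal_cone_def mink_self time_vector_def mink_def[of v])
qed

lemma future_timelike_iff: "future_timelike v \<longleftrightarrow> v \<in> chron_cone"
proof -
  have "v \<noteq> 0 \<and> (norm (snd v))\<^sup>2 < (fst v)\<^sup>2 \<and> fst v > 0 \<longleftrightarrow> norm (snd v) < fst v"
    by (auto intro: power_strict_mono dest: power2_less_imp_less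
        intro: le_less_trans[OF norm_ge_zero])
  then show ?thesis
    by (auto simp: future_timelike_def timelike_def chron_cone_def mink_self time_vector_def
        mink_def[of v])
qed

lemma lightlike_iff: "lightlike v \<longleftrightarrow> v \<noteq> 0 \<and> norm (snd v) = \<bar>fst v\<bar>"
proof -
  have "(norm (snd v))\<^sup>2 = (fst v)\<^sup>2 \<longleftrightarrow> norm (snd v) = \<bar>fst v\<bar>"
    by (metis power2_abs power2_eq_iff_nonneg abs_ge_zero norm_ge_zero)
  then show ?thesis by (simp add: lightlike_def mink_self)
qed

lemma piecewise_smooth_segment:
  fixes x v :: "'a::real_normed_vector"
  assumes "P v"
  shows "piecewise_smooth_curve_with_velocity P 0 1 (\<lambda>t. x + t *\<^sub>R v)"
proof -
  define D :: "nat \<Rightarrow> real \<Rightarrow> 'a" where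
    "D k t = (if k = 0 then x + t *\<^sub>R v else if k = 1 then v else 0)" for k t
  have D: "(D k has_vector_derivative D (Suc k) t) (at t within {0..1})" for k t
    by (cases k) (auto simp: D_def[abs_def] intro!: derivative_eq_intros)
  have "smooth_on_segment 0 1 (\<lambda>t. x + t *\<^sub>R v)"
    unfolding smooth_on_segment_def by (rule exI[of _ D]) (use D in \<open>auto simp: D_def\<close>)
  moreover have "vector_derivative (\<lambda>t. x + t *\<^sub>R v) (at t within {0..1}) = v"
    if "t \<in> {0..1}" for t :: real
    using that by (intro vector_derivative_within_cbox[of 0 1 t, unfolded cbox_interval]) (auto intro!: derivative_eq_intros)
  \<comment> \<open>One piece suffices; the embedding \<open>real\<close> of the naturals lists its
    end points 0 and 1.\<close>
  ultimately show ?thesis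
    unfolding piecewise_smooth_curve_with_velocity_def using assms
    by (intro exI[of _ 1] exI[of _ real]) auto
qed

text \<open>The mean value theorem needs a scalar function, hence the functional \<open>L\<close>.
  The set \<open>S\<close> is kept abstract so that \<open>{0..}\<close> and \<open>{0<..}\<close>
  treat causal and timelike curves at once.\<close>

lemma piecewise_smooth_curve_displacement:
  fixes \<gamma> :: "real \<Rightarrow> 'a::real_normed_vector" and L :: "'a \<Rightarrow> real"
  assumes curve: "piecewise_smooth_curve_with_velocity P a b \<gamma>"
    and L: "bounded_linear L"
    and vel: "\<And>v. P v \<Longrightarrow> L v \<in> S"
    and add: "\<And>x y. x \<in> S \<Longrightarrow> y \<in> S \<Longrightarrow> x + y \<in> S"
    and scale: "\<And>c x. 0 < c \<Longrightarrow> x \<in> S \<Longrightarrow> c * x \<in> S"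
  shows "L (\<gamma> b - \<gamma> a) \<in> S"
proof -
  interpret L: bounded_linear L by (rule L)
  obtain N p where N: "1 \<le> N" and p0: "p 0 = a" and pN: "p N = b"
    and pieces: "\<And>i. i < N \<Longrightarrow> p i < p (Suc i) \<and> smooth_on_segment (p i) (p (Suc i)) \<gamma> \<and>
      (\<forall>t\<in>{p i..p (Suc i)}. P (vector_derivative \<gamma> (at t within {p i..p (Suc i)})))"
    using curve unfolding piecewise_smooth_curve_with_velocity_def by blast
  have piece: "L (\<gamma> (p (Suc i)) - \<gamma> (p i)) \<in> S" if i: "i < N" for i
  proof -
    let ?I = "{p i..p (Suc i)}"
    have lt: "p i < p (Suc i)" using pieces[OF i] by blast
    obtain D where D0: "\<And>t. t \<in> ?I \<Longrightarrow> D 0 t = \<gamma> t"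
      and D: "\<And>k t. t \<in> ?I \<Longrightarrow> (D k has_vector_derivative D (Suc k) t) (at t within ?I)"
      using pieces[OF i] unfolding smooth_on_segment_def by blast
    have der: "(\<gamma> has_vector_derivative D 1 t) (at t within ?I)" if t: "t \<in> ?I" for t
      using D[OF t, of 0] D0 has_vector_derivative_transform[OF t, of \<gamma> "D 0" "D 1 t"] by simp
    have "P (D 1 t)" if t: "t \<in> ?I" for t
    proof -
      have "vector_derivative \<gamma> (at t within ?I) = D 1 t"
        using vector_derivative_within_cbox[of "p i" "p (Suc i)" t \<gamma> "D 1 t"] der[OF t] t lt by auto
      then show ?thesis using pieces[OF i] t by metis
    qed
    moreover have "((\<lambda>t. L (\<gamma> t)) has_derivative (\<lambda>h. L (h *\<^sub>R D 1 t))) (at t within ?I)"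
      if "p i \<le> t" "t \<le> p (Suc i)" for t
      using der[of t] that unfolding has_vector_derivative_def
      by (auto intro: L.has_derivative)
    then have "\<exists>t\<in>{p i<..<p (Suc i)}. L (\<gamma> (p (Suc i))) - L (\<gamma> (p i)) = L ((p (Suc i) - p i) *\<^sub>R D 1 t)"
      by (rule mvt_simple[OF lt])
    then obtain t where "t \<in> {p i<..<p (Suc i)}"
      "L (\<gamma> (p (Suc i))) - L (\<gamma> (p i)) = L ((p (Suc i) - p i) *\<^sub>R D 1 t)" by blast
    ultimately show ?thesis
      using lt by (auto simp: L.diff L.scaleR intro!: scale vel)
  qed
  have "L (\<gamma> (p (Suc k)) - \<gamma> (p 0)) \<in> S" if "Suc k \<le> N" for k
    using that
  proof (induction k)
    case 0
    then show ?case using piece[of 0] by simp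
  next
    case (Suc k)
    then show ?case using add[OF Suc.IH piece[of "Suc k"]] by (simp add: L.diff)
  qed
  from this[of "N - 1"] show ?thesis using N p0 pN by simp
qed

text \<open>The functional is adapted to the displacement \<open>d\<close>: it projects on the
  spatial direction of \<open>d\<close>, so it computes the slack of \<open>d\<close> exactly and
  never falls below the slack of any other vector. For \<open>snd d = 0\<close> the direction is
  \<open>sgn 0 = 0\<close>.\<close>

lemma snd_displacement_functional:
  fixes d :: "'n::finite minkowski"
  defines "L \<equiv> (\<lambda>v::'n minkowski. fst v - sgn (snd d) \<bullet> snd v)"
  shows "bounded_linear L" "L d = fst d - norm (snd d)" "fst v - norm (snd v) \<le> L v"
proof -
  show "bounded_linear L"
    unfolding L_def
    by (rule bounded_linear_sub[OF bounded_linear_fst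
        bounded_linear_compose[OF bounded_linear_inner_right bounded_linear_snd]])
  show "L d = fst d - norm (snd d)"
    by (cases "snd d = 0")
      (simp_all add: L_def sgn_div_norm power2_eq_square field_simps flip: power2_norm_eq_inner)
  have "sgn (snd d) \<bullet> snd v \<le> norm (sgn (snd d)) * norm (snd v)"
    by (rule norm_cauchy_schwarz)
  also have "\<dots> \<le> norm (snd v)" by (simp add: norm_sgn)
  finally show "fst v - norm (snd v) \<le> L v" by (simp add: L_def)
qed

lemma future_causal_curve_displacement:
  assumes "future_causal_curve a b \<gamma>"
  shows "\<gamma> b - \<gamma> a \<in> causal_cone"
proof -
  define L where "L v = fst v - sgn (snd (\<gamma> b - \<gamma> a)) \<bullet> snd v" for v :: "'a minkowski"
  note L = snd_displacement_functional[where d = "\<gamma> b - \<gamma> a", folded L_def]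
  have "L (\<gamma> b - \<gamma> a) \<in> {0..}"
    using assms[unfolded future_causal_curve_def] L(1)
  proof (rule piecewise_smooth_curve_displacement)
    show "L v \<in> {0..}" if "future_causal v" for v
      using that L(3)[of v] by (auto simp: future_causal_iff causal_cone_def)
  qed auto
  then show ?thesis using L(2) by (simp add: causal_cone_def)
qed

lemma future_timelike_curve_displacement:
  assumes "future_timelike_curve a b \<gamma>"
  shows "\<gamma> b - \<gamma> a \<in> chron_cone"
proof -
  define L where "L v = fst v - sgn (snd (\<gamma> b - \<gamma> a)) \<bullet> snd v" for v :: "'a minkowski"
  note L = snd_displacement_functional[where d = "\<gamma> b - \<gamma> a", folded L_def]
  have "L (\<gamma> b - \<gamma> a) \<in> {0<..}"
    using assms[unfolded future_timelike_curve_def] L(1)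
  proof (rule piecewise_smooth_curve_displacement)
    show "L v \<in> {0<..}" if "future_timelike v" for v
      using that L(3)[of v] by (auto simp: future_timelike_iff chron_cone_def)
  qed auto
  then show ?thesis using L(2) by (simp add: chron_cone_def)
qed

text \<open>The cone is convex, so a causal curve can be replaced by a straight segment; this
  removes curves from the rest of the argument.\<close>

lemma causal_le_iff: "causal_le x y \<longleftrightarrow> y - x \<in> causal_cone"
proof
  assume "causal_le x y"
  then show "y - x \<in> causal_cone"
    unfolding causal_le_def using future_causal_curve_displacement by fastforce
next
  assume "y - x \<in> causal_cone"
  then show "causal_le x y"
    unfolding causal_le_def future_causal_curve_def
    using piecewise_smooth_segment[of future_causal "y - x" x]
    by (cases "x = y") (fastforce simp: future_causal_iff)+
qed

lemma causal_past_eq: "causal_past x = {y. x - y \<in> causal_cone}"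
  by (simp add: causal_past_def causal_le_iff)

lemma chronological_future_eq: "chronological_future A = {y. \<exists>x\<in>A. y - x \<in> chron_cone}"
proof -
  have "(\<exists>a b \<gamma>. future_timelike_curve a b \<gamma> \<and> \<gamma> a = x \<and> \<gamma> b = y) \<longleftrightarrow> y - x \<in> chron_cone" for x y :: "'a minkowski"
    using piecewise_smooth_segment[of future_timelike "y - x" x] future_timelike_curve_displacement
    unfolding future_timelike_curve_def by (fastforce simp: future_timelike_iff)
  then show ?thesis unfolding chronological_future_def by simp
qed

lemma future_complete_add:
  assumes "future_complete \<Omega>" "x \<in> \<Omega>" "v \<in> causal_cone"
  shows "x + v \<in> \<Omega>"
proof (cases "v = 0")
  case False
  then have "future_causal_curve 0 1 (\<lambda>t. x + t *\<^sub>R v)"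
    unfolding future_causal_curve_def
    using assms(3) by (intro piecewise_smooth_segment) (simp add: future_causal_iff)
  then have "(\<lambda>t. x + t *\<^sub>R v) ` {0..1} \<subseteq> \<Omega>"
    using assms(1,2) unfolding future_complete_def by (metis add.right_neutral scaleR_zero_left)
  then show ?thesis by (auto dest!: subsetD[where c = "x + v"] intro!: image_eqI[where x = 1])
qed (use assms in simp)

section \<open>Cosmological time of convex future complete domains\<close>

locale future_convex_domain =
  fixes \<Omega> :: "'n::finite minkowski set"
  assumes open_domain: "open \<Omega>"
    and convex_domain: "convex \<Omega>"
    and domain_nonempty: "\<Omega> \<noteq> {}"
    and domain_not_UNIV: "\<Omega> \<noteq> UNIV"
    and add_causal: "x \<in> \<Omega> \<Longrightarrow> v \<in> causal_cone \<Longrightarrow> x + v \<in> \<Omega>"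
    and no_lightlike_line: "lightlike v \<Longrightarrow> \<exists>s. x + s *\<^sub>R v \<notin> \<Omega>"
begin

abbreviation tau :: "'n minkowski \<Rightarrow> real" where
  "tau \<equiv> cosmological_time \<Omega>"

text \<open>The chronological past of \<open>r + z\<close> is an open neighbourhood of
  \<open>r\<close>, hence contains a point of the domain.\<close>

lemma closure_add_chron:
  assumes "r \<in> closure \<Omega>" "z \<in> chron_cone"
  shows "r + z \<in> \<Omega>"
proof -
  have "open ((\<lambda>s. r + z - s) -` chron_cone)"
    by (rule open_vimage[OF open_chron_cone]) (intro continuous_intros)
  moreover have "r \<in> (\<lambda>s. r + z - s) -` chron_cone" using assms(2) by simp
  ultimately obtain s where s: "s \<in> \<Omega>" "r + z - s \<in> chron_cone"
    using assms(1) open_Int_closure_eq_empty[of "(\<lambda>s. r + z - s) -` chron_cone" \<Omega>] by blast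
  then have "s + (r + z - s) \<in> \<Omega>" using add_causal chron_cone_subset_causal_cone by blast
  then show ?thesis by simp
qed

section \<open>Past rays and their exit points\<close>

lemma past_mono:
  assumes "x - s *\<^sub>R v \<notin> \<Omega>" "v \<in> causal_cone" "s \<le> s'"
  shows "x - s' *\<^sub>R v \<notin> \<Omega>"
proof
  assume "x - s' *\<^sub>R v \<in> \<Omega>"
  then have "x - s' *\<^sub>R v + (s' - s) *\<^sub>R v \<in> \<Omega>"
    using assms by (intro add_causal causal_cone_scaleR) auto
  then show False using assms(1) by (simp add: algebra_simps)
qed

text \<open>A timelike ray eventually enters the past of a point outside the domain. A lightlike
  line leaves the domain somewhere, and \<open>past_mono\<close> moves this exit to the past
  side.\<close>

lemma leaves_domain_to_past:
  assumes "v \<in> causal_cone" "v \<noteq> 0"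
  obtains s where "s > 0" "x - s *\<^sub>R v \<notin> \<Omega>"
proof -
  have "\<exists>s. x - s *\<^sub>R v \<notin> \<Omega>"
  proof (cases "v \<in> chron_cone")
    case True
    obtain z where z: "z \<notin> \<Omega>" using domain_not_UNIV by blast
    obtain s0 where "\<And>s. s \<ge> s0 \<Longrightarrow> (z - x) + s *\<^sub>R v \<in> chron_cone"
      using chron_cone_absorbs[OF True, of "z - x"] by blast
    then have "(z - x) + s0 *\<^sub>R v \<in> chron_cone" by simp
    then have "x - s0 *\<^sub>R v \<in> \<Omega> \<Longrightarrow> x - s0 *\<^sub>R v + ((z - x) + s0 *\<^sub>R v) \<in> \<Omega>"
      by (metis add_causal chron_cone_subset_causal_cone)
    then show ?thesis using z by auto
  next
    case False
    then have "lightlike v"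
      using assms causal_cone_fst_nonneg[OF assms(1)]
      by (auto simp: lightlike_iff causal_cone_def chron_cone_def)
    then obtain s where "x + s *\<^sub>R v \<notin> \<Omega>" using no_lightlike_line by blast
    then have "x - (- s) *\<^sub>R v \<notin> \<Omega>" by simp
    then show ?thesis by blast
  qed
  then obtain s where s: "x - s *\<^sub>R v \<notin> \<Omega>" by blast
  show thesis
    by (rule that[of "max s 1"]) (use past_mono[OF s assms(1), of "max s 1"] in auto)
qed

text \<open>In a convex set the points strictly between a closure point and an interior point are
  interior. The shrinking factor \<open>1 - s / s'\<close> is the one that lands at parameter
  \<open>s\<close>.\<close>

lemma past_ray_not_in_closure:
  assumes "x \<in> \<Omega>" "x - s *\<^sub>R v \<notin> \<Omega>" "0 < s" "s < s'"
  shows "x - s' *\<^sub>R v \<notin> closure \<Omega>"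
proof
  assume "x - s' *\<^sub>R v \<in> closure \<Omega>"
  then have "x - s' *\<^sub>R v - (1 - s / s') *\<^sub>R (x - s' *\<^sub>R v - x) \<in> interior \<Omega>"
    using assms open_domain
    by (intro mem_interior_closure_convex_shrink convex_domain) (auto simp: interior_open)
  moreover have "x - s' *\<^sub>R v - (1 - s / s') *\<^sub>R (x - s' *\<^sub>R v - x)
      = x - (s' - (1 - s / s') * s') *\<^sub>R v"
    by (simp add: algebra_simps)
  moreover have "s' - (1 - s / s') * s' = s" using assms by (simp add: field_simps)
  ultimately have "x - s *\<^sub>R v \<in> interior \<Omega>" by metis
  then show False using assms(2) interior_subset by blast
qed

text \<open>The last conclusion includes negative \<open>s\<close>: the ray inside the domain is an
  entire half-line, as needed for its projective parametrization.\<close>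

lemma past_exit:
  assumes "x \<in> \<Omega>" "v \<in> causal_cone" "v \<noteq> 0"
  obtains h0 where "h0 > 0" "x - h0 *\<^sub>R v \<notin> \<Omega>" "\<And>s. s < h0 \<Longrightarrow> x - s *\<^sub>R v \<in> \<Omega>"
proof -
  define S where "S = {0..} \<inter> (\<lambda>s. x - s *\<^sub>R v) -` (- \<Omega>)"
  have "closed ((\<lambda>s. x - s *\<^sub>R v) -` (- \<Omega>))"
    by (rule closed_vimage) (use open_domain in \<open>auto intro!: continuous_intros\<close>)
  then have closed: "closed S" unfolding S_def by (intro closed_Int) auto
  have bdd: "bdd_below S" by (auto simp: S_def bdd_below_def)
  obtain s1 where "s1 > 0" "x - s1 *\<^sub>R v \<notin> \<Omega>"
    using leaves_domain_to_past[OF assms(2,3)] by blast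
  then have ne: "S \<noteq> {}" by (auto simp: S_def intro: less_imp_le)
  have Inf: "Inf S \<in> S" by (rule closed_contains_Inf[OF ne bdd closed])
  show thesis
  proof (rule that[of "Inf S"])
    show "x - Inf S *\<^sub>R v \<notin> \<Omega>" using Inf by (simp add: S_def)
    moreover have "Inf S \<noteq> 0" using Inf assms(1) by (auto simp: S_def)
    ultimately show "Inf S > 0" using Inf by (auto simp: S_def)
    fix s assume s: "s < Inf S"
    show "x - s *\<^sub>R v \<in> \<Omega>"
    proof (rule ccontr)
      assume "x - s *\<^sub>R v \<notin> \<Omega>"
      then have "x - max s 0 *\<^sub>R v \<notin> \<Omega>" using past_mono[OF _ assms(2)] by simp
      then have "max s 0 \<in> S" by (simp add: S_def)
      then have "Inf S \<le> max s 0" by (rule cInf_lower[OF _ bdd])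
      then show False using s \<open>Inf S > 0\<close> by simp
    qed
  qed
qed

text \<open>The normalised past causal directions form a compact set, so the past directed causal
  rays leave the closure of the domain within a uniform time.\<close>

lemma bounded_past:
  assumes x: "x \<in> \<Omega>"
  shows "bounded (closure \<Omega> \<inter> {y. x - y \<in> causal_cone})"
proof -
  define D :: "'n minkowski set" where "D = {1} \<times> cball 0 1"
  have D: "w \<in> causal_cone \<and> w \<noteq> 0" if "w \<in> D" for w
    using that by (auto simp: D_def causal_cone_def zero_prod_def)
  define U where "U n = (\<lambda>w. x - real (Suc n) *\<^sub>R w) -` (- closure \<Omega>)" for n
  have "compact D" unfolding D_def by (intro compact_Times) auto
  moreover have "open (U n)" for n
    unfolding U_def by (rule open_vimage) (auto intro!: continuous_intros)
  moreover have "D \<subseteq> (\<Union>n. U n)"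
  proof
    fix w assume w: "w \<in> D"
    obtain s where s: "s > 0" "x - s *\<^sub>R w \<notin> \<Omega>"
      using leaves_domain_to_past D[OF w] by blast
    obtain n where "s < real (Suc n)" using reals_Archimedean2[of s] by (metis lessI less_trans of_nat_less_iff)
    then have "w \<in> U n" unfolding U_def using past_ray_not_in_closure[OF x s(2,1)] by simp
    then show "w \<in> (\<Union>n. U n)" by (rule UN_I[OF UNIV_I])
  qed
  ultimately obtain F where F: "finite F" "D \<subseteq> (\<Union>n\<in>F. U n)"
    by (rule compactE_image[of D UNIV U])
  \<comment> \<open>Inserting 0 keeps \<open>Max\<close> meaningful for empty
    \<open>F\<close>.\<close>
  define M where "M = real (Suc (Max (insert 0 F)))"
  have M: "f \<le> M" if f: "x - f *\<^sub>R w \<in> closure \<Omega>" and w: "w \<in> D" for w f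
  proof -
    obtain n where n: "n \<in> F" "w \<in> U n" using F w by blast
    then have out: "x - real (Suc n) *\<^sub>R w \<notin> closure \<Omega>" by (simp add: U_def)
    then have "x - real (Suc n) *\<^sub>R w \<notin> \<Omega>" using closure_subset by blast
    then have "\<not> real (Suc n) < f" using past_ray_not_in_closure[OF x] f by fastforce
    moreover have "real (Suc n) \<le> M" using n(1) F(1) by (simp add: M_def)
    ultimately show ?thesis by linarith
  qed
  have "norm (y - x) \<le> 2 * M" if y: "y \<in> closure \<Omega>" "x - y \<in> causal_cone" for y
  proof -
    define f where "f = fst (x - y)"
    have f0: "f \<ge> 0" using causal_cone_fst_nonneg[OF y(2)] by (simp add: f_def)
    have fM: "f \<le> M"
    proof (cases "f = 0")
      case False
      define w where "w = (1 / f) *\<^sub>R (x - y)"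
      have "fst w = (1 / f) * f" "norm (snd w) = (1 / f) * norm (snd (x - y))"
        using f0 unfolding w_def f_def by (simp_all only: fst_scaleR snd_scaleR norm_scaleR) simp_all
      moreover have "(1 / f) * norm (snd (x - y)) \<le> (1 / f) * f"
        using y(2) f0 by (intro mult_left_mono) (auto simp: causal_cone_def f_def)
      ultimately have "w \<in> D" using False by (simp add: D_def mem_Times_iff)
      moreover have "x - f *\<^sub>R w = y" using False by (simp add: w_def)
      ultimately show ?thesis using M y(1) by metis
    qed (simp add: M_def)
    have "norm (x - y) \<le> norm (fst (x - y)) + norm (snd (x - y))"
      using norm_Pair_le[of "fst (x - y)" "snd (x - y)"] by (simp only: prod.collapse)
    also have "\<dots> \<le> f + f" using y(2) f0 by (auto simp: f_def causal_cone_def)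
    finally show ?thesis using fM by (simp add: norm_minus_commute)
  qed
  then have "closure \<Omega> \<inter> {y. x - y \<in> causal_cone} \<subseteq> cball x (2 * M)"
    by (auto simp: dist_norm norm_minus_commute)
  then show ?thesis by (rule bounded_subset[OF bounded_cball])
qed

lemma compact_past:
  assumes "x \<in> \<Omega>"
  shows "compact (closure \<Omega> \<inter> {y. x - y \<in> causal_cone})"
proof -
  have "closed ((\<lambda>y. x - y) -` causal_cone)"
    by (rule closed_vimage[OF closed_causal_cone]) (intro continuous_intros)
  then have "closed {y. x - y \<in> causal_cone}" by (simp add: vimage_def)
  then show ?thesis
    using bounded_past[OF assms] by (simp add: compact_eq_bounded_closed closed_Int)
qed

section \<open>Finiteness, positivity and attainment of the cosmological time\<close>

lemma tau_eq: "tau x = (SUP y\<in>\<Omega> \<inter> {y. x - y \<in> causal_cone}. lorentz_norm (x - y))"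
  by (simp add: cosmological_time_def causal_past_eq lorentz_time_def lorentz_norm_def)

lemma bdd_above_lorentz_norm:
  assumes "x \<in> \<Omega>"
  shows "bdd_above ((\<lambda>y. lorentz_norm (x - y)) ` (\<Omega> \<inter> {y. x - y \<in> causal_cone}))"
proof -
  have "compact ((\<lambda>y. lorentz_norm (x - y)) ` (closure \<Omega> \<inter> {y. x - y \<in> causal_cone}))"
    by (intro compact_continuous_image compact_past[OF assms] continuous_intros)
  then have "bdd_above ((\<lambda>y. lorentz_norm (x - y)) ` (closure \<Omega> \<inter> {y. x - y \<in> causal_cone}))"
    by (intro bounded_imp_bdd_above compact_imp_bounded)
  then show ?thesis by (rule bdd_above_mono) (use closure_subset in auto)
qed

lemma lorentz_norm_le_tau:
  assumes "x \<in> \<Omega>" "y \<in> \<Omega>" "x - y \<in> causal_cone"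
  shows "lorentz_norm (x - y) \<le> tau x"
  unfolding tau_eq by (rule cSUP_upper) (use assms bdd_above_lorentz_norm in auto)

lemma tau_le:
  assumes "x \<in> \<Omega>" "\<And>y. y \<in> \<Omega> \<Longrightarrow> x - y \<in> causal_cone \<Longrightarrow> lorentz_norm (x - y) \<le> c"
  shows "tau x \<le> c"
  unfolding tau_eq by (rule cSUP_least) (use assms in \<open>auto intro!: exI[of _ x]\<close>)

text \<open>Moving \<open>r\<close> slightly towards \<open>x\<close> enters the domain and shortens
  the distance only by a factor close to 1. Outside the chronological case the distance is
  zero.\<close>

lemma lorentz_norm_le_tau_closure:
  assumes x: "x \<in> \<Omega>" and r: "r \<in> closure \<Omega>" and J: "x - r \<in> causal_cone"
  shows "lorentz_norm (x - r) \<le> tau x"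
proof (cases "x - r \<in> chron_cone")
  case True
  have "z * lorentz_norm (x - r) \<le> tau x" if z: "0 < z" "z < 1" for z
  proof -
    define e where "e = 1 - z"
    then have e: "0 < e" "e < 1" using z by auto
    have "r + e *\<^sub>R (x - r) \<in> \<Omega>"
      using closure_add_chron[OF r] chron_cone_scaleR[OF True e(1)] by blast
    moreover have eq: "x - (r + e *\<^sub>R (x - r)) = (1 - e) *\<^sub>R (x - r)" by (simp add: algebra_simps)
    ultimately have "lorentz_norm ((1 - e) *\<^sub>R (x - r)) \<le> tau x"
      using lorentz_norm_le_tau[OF x, of "r + e *\<^sub>R (x - r)"] causal_cone_scaleR[OF J, of "1 - e"] e
      unfolding eq by simp
    then show ?thesis using e by (simp add: lorentz_norm_scaleR e_def)
  qed
  then show ?thesis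
    by (rule field_le_mult_one_interval)
next
  case False
  then have "lorentz_norm (x - r) = 0"
    using lorentz_norm_pos_imp_chron[OF J] by (metis lorentz_norm_nonneg order_le_less)
  moreover have "0 \<le> tau x" using lorentz_norm_le_tau[OF x x] by (simp add: lorentz_norm_def mink_algebra)
  ultimately show ?thesis by simp
qed

lemma tau_pos:
  assumes "x \<in> \<Omega>"
  shows "tau x > 0"
proof -
  have "open ((\<lambda>e::real. x - e *\<^sub>R time_vector) -` \<Omega>)"
    by (rule open_vimage[OF open_domain]) (intro continuous_intros)
  then obtain e where e: "e > 0" "cball 0 e \<subseteq> (\<lambda>e::real. x - e *\<^sub>R time_vector) -` \<Omega>"
    using assms open_contains_cball_eq[of "(\<lambda>e::real. x - e *\<^sub>R time_vector) -` \<Omega>" ]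
    by (metis (no_types, lifting) diff_zero scaleR_zero_left vimageI2)
  then have "x - e *\<^sub>R time_vector \<in> \<Omega>" by (auto dest: subsetD[where c = e])
  moreover have C: "e *\<^sub>R time_vector \<in> chron_cone"
    using time_vector_in_chron_cone e(1) by (rule chron_cone_scaleR)
  ultimately show ?thesis
    using lorentz_norm_le_tau[OF assms, of "x - e *\<^sub>R time_vector"] lorentz_norm_pos[OF C]
      chron_cone_subset_causal_cone[OF C] by (smt (verit) add_diff_cancel_left' diff_diff_eq2)
qed

text \<open>Passing to the closure makes the past of \<open>x\<close> compact without changing the
  supremum; positivity of \<open>tau\<close> then excludes a maximiser on the past light
  cone.\<close>

lemma tau_attained:
  assumes "x \<in> \<Omega>"
  obtains r where "r \<in> closure \<Omega>" "x - r \<in> chron_cone" "lorentz_norm (x - r) = tau x"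
proof -
  define K where "K = closure \<Omega> \<inter> {y. x - y \<in> causal_cone}"
  have "x \<in> K" using assms closure_subset by (auto simp: K_def)
  then have "\<exists>r\<in>K. \<forall>y\<in>K. lorentz_norm (x - y) \<le> lorentz_norm (x - r)"
    using compact_past[OF assms, folded K_def]
    by (intro continuous_attains_sup continuous_intros) auto
  then obtain r where r: "r \<in> K" "\<And>y. y \<in> K \<Longrightarrow> lorentz_norm (x - y) \<le> lorentz_norm (x - r)"
    by blast
  have "tau x \<le> lorentz_norm (x - r)"
    by (rule tau_le[OF assms]) (use r(2) closure_subset in \<open>auto simp: K_def\<close>)
  moreover have "lorentz_norm (x - r) \<le> tau x"
    using r(1) assms by (intro lorentz_norm_le_tau_closure) (auto simp: K_def)
  ultimately have eq: "lorentz_norm (x - r) = tau x" by simp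
  then have "x - r \<in> chron_cone"
    using r(1) tau_pos[OF assms] by (intro lorentz_norm_pos_imp_chron) (auto simp: K_def)
  then show thesis using that[of r] eq r(1) by (simp add: K_def)
qed

lemma tau_mono:
  assumes "x \<in> \<Omega>" "v \<in> causal_cone"
  shows "tau x \<le> tau (x + v)"
proof (rule tau_le[OF assms(1)])
  fix y assume y: "y \<in> \<Omega>" "x - y \<in> causal_cone"
  have "lorentz_norm (x - y) \<le> lorentz_norm (x - y + v)"
    by (rule lorentz_norm_mono[OF y(2) assms(2)])
  also have "\<dots> = lorentz_norm (x + v - y)" by (simp add: algebra_simps)
  also have "\<dots> \<le> tau (x + v)"
    using causal_cone_add[OF y(2) assms(2)] y(1) add_causal[OF assms]
    by (intro lorentz_norm_le_tau) (auto simp: algebra_simps)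
  finally show "lorentz_norm (x - y) \<le> tau (x + v)" .
qed

text \<open>The homothety of centre \<open>b\<close> and ratio \<open>c\<close> maps the past of \<open>y\<close> in the domain into the
  past of the image of \<open>y\<close>, and scales Lorentzian lengths by \<open>c\<close>.\<close>

lemma tau_homothety:
  assumes "b \<in> \<Omega>" "b + u \<in> \<Omega>" "0 < c" "c \<le> 1"
  shows "c * tau (b + u) \<le> tau (b + c *\<^sub>R u)"
proof -
  have im: "b + c *\<^sub>R (z - b) \<in> \<Omega>" if "z \<in> \<Omega>" for z
    using convexD_alt[OF convex_domain assms(1) that, of c] assms(3,4) by (simp add: algebra_simps)
  have x: "b + c *\<^sub>R u \<in> \<Omega>" using im[OF assms(2)] by simp
  have "tau (b + u) \<le> tau (b + c *\<^sub>R u) / c"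
  proof (rule tau_le[OF assms(2)])
    fix y assume y: "y \<in> \<Omega>" "b + u - y \<in> causal_cone"
    have eq: "b + c *\<^sub>R u - (b + c *\<^sub>R (y - b)) = c *\<^sub>R (b + u - y)" by (simp add: algebra_simps)
    have "lorentz_norm (c *\<^sub>R (b + u - y)) \<le> tau (b + c *\<^sub>R u)"
      using lorentz_norm_le_tau[OF x im[OF y(1)]] causal_cone_scaleR[OF y(2), of c] assms(3)
      unfolding eq by simp
    then have "c * lorentz_norm (b + u - y) \<le> tau (b + c *\<^sub>R u)"
      using assms(3) by (simp only: lorentz_norm_scaleR[OF less_imp_le])
    then show "lorentz_norm (b + u - y) \<le> tau (b + c *\<^sub>R u) / c"
      using assms(3) by (simp add: pos_le_divide_eq mult.commute)
  qed
  then show ?thesis using assms(3) by (simp add: pos_le_divide_eq mult.commute)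
qed

end

section \<open>Chains of light rays and of causal pairs\<close>

definition light_cone :: "'n::finite minkowski set" where
  "light_cone = {v. norm (snd v) = fst v}"

lemma light_cone_subset_causal_cone: "v \<in> light_cone \<Longrightarrow> v \<in> causal_cone"
  by (simp add: light_cone_def causal_cone_def)

lemma light_cone_mink: "v \<in> light_cone \<Longrightarrow> mink v v = 0"
  by (simp add: light_cone_def mink_self)

lemma light_cone_scaleR: "v \<in> light_cone \<Longrightarrow> 0 \<le> c \<Longrightarrow> c *\<^sub>R v \<in> light_cone"
  by (simp add: light_cone_def)

lemma zero_in_light_cone [simp]: "0 \<in> light_cone"
  by (simp add: light_cone_def)

lemma light_cone_lightlike: "v \<in> light_cone \<Longrightarrow> v \<noteq> 0 \<Longrightarrow> lightlike v"
  using causal_cone_fst_nonneg[OF light_cone_subset_causal_cone, of v]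
  by (simp add: light_cone_def lightlike_iff)

lemma lightlike_cases: "lightlike v \<Longrightarrow> v \<in> light_cone \<or> - v \<in> light_cone"
  by (auto simp: lightlike_iff light_cone_def abs_if split: if_splits)

lemma direction_exists:
  fixes y :: "(real, 'n::finite) vec"
  obtains e where "norm e = 1" "y = norm y *\<^sub>R e"
proof (cases "y = 0")
  case True
  obtain e :: "(real, 'n) vec" where "norm e = 1" by (metis vector_choose_size zero_le_one)
  then show ?thesis using that True by simp
next
  case False
  then show ?thesis using that[of "(1 / norm y) *\<^sub>R y"] by simp
qed

lemma lightlike_exists:
  obtains u :: "'n::finite minkowski" where "u \<in> light_cone" "u \<noteq> 0"
proof -
  obtain e :: "(real, 'n) vec" where "norm e = 1" by (rule direction_exists[of 0])
  then show thesis using that[of "(1, e)"] by (simp add: light_cone_def zero_prod_def)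
qed

text \<open>These are null coordinates in the plane of the time axis and the spatial direction
  \<open>e\<close> of \<open>v\<close>; if \<open>v\<close> has no spatial part, any unit vector
  serves as \<open>e\<close>.\<close>

lemma lightlike_decomposition:
  fixes v :: "'n::finite minkowski"
  assumes "v \<in> causal_cone"
  obtains u w where "u \<in> light_cone" "w \<in> light_cone" "v = u + w"
proof -
  obtain e :: "(real, 'n) vec" where e: "norm e = 1" "snd v = norm (snd v) *\<^sub>R e"
    by (rule direction_exists)
  define p where "p = (fst v + norm (snd v)) / 2"
  define q where "q = (fst v - norm (snd v)) / 2"
  have pq: "p \<ge> 0" "q \<ge> 0"
    using assms causal_cone_fst_nonneg[OF assms] by (auto simp: p_def q_def causal_cone_def)
  show thesis
  proof (rule that)
    show "p *\<^sub>R (1, e) \<in> light_cone" "q *\<^sub>R (1, - e) \<in> light_cone"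
      using pq e(1) by (auto simp: light_cone_def)
    have "p - q = norm (snd v)" by (simp add: p_def q_def field_simps)
    then have "snd v = (p - q) *\<^sub>R e" using e(2) by metis
    moreover have "fst v = p + q" by (simp add: p_def q_def field_simps)
    ultimately show "v = p *\<^sub>R (1, e) + q *\<^sub>R (1, - e)"
      by (simp add: prod_eq_iff scaleR_diff_left)
  qed
qed

section \<open>Chain sums under the two infima\<close>

definition markowitz_sums :: "'n::finite minkowski set \<Rightarrow> 'n minkowski \<Rightarrow> 'n minkowski \<Rightarrow> real set" where
  "markowitz_sums \<Omega> x y =
     {\<Sum>k=1..m. rho_I (s k) (t k) |
            (m::nat) (\<gamma> :: nat \<Rightarrow> real \<Rightarrow> 'n minkowski) (s :: nat \<Rightarrow> real) (t :: nat \<Rightarrow> real).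
            1 \<le> m \<and>
            (\<forall>k\<in>{1..m}. projective_lightlike_geodesic \<Omega> (\<gamma> k) \<and>
                        s k \<in> {-1<..<1} \<and> t k \<in> {-1<..<1}) \<and>
            \<gamma> 1 (s 1) = x \<and> \<gamma> m (t m) = y \<and>
            (\<forall>k\<in>{1..<m}. \<gamma> k (t k) = \<gamma> (Suc k) (s (Suc k)))}"

definition null_sums ::
  "'n::finite minkowski set \<Rightarrow> ('n minkowski \<Rightarrow> real) \<Rightarrow> 'n minkowski \<Rightarrow> 'n minkowski \<Rightarrow> real set" where
  "null_sums \<Omega> T x y =
     {\<Sum>k=1..<m. \<bar>T (z (Suc k)) - T (z k)\<bar> |(m::nat) (z :: nat \<Rightarrow> 'n minkowski).
            1 \<le> m \<and> z 1 = x \<and> z m = y \<and> (\<forall>k\<in>{1..m}. z k \<in> \<Omega>) \<and>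
            (\<forall>k\<in>{1..<m}. causally_related (z k) (z (Suc k)))}"

lemma markowitz_distance_eq: "markowitz_distance \<Omega> x y = Inf (markowitz_sums \<Omega> x y)"
  by (simp add: markowitz_distance_def markowitz_sums_def)

lemma null_distance_eq: "null_distance \<Omega> T x y = Inf (null_sums \<Omega> T x y)"
  by (simp add: null_distance_def null_sums_def)

lemma rho_I_nonneg [simp]: "0 \<le> rho_I s t"
  by (simp add: rho_I_def)

lemma rho_I_commute:
  assumes "s \<in> {-1<..<1}" "t \<in> {-1<..<1}"
  shows "rho_I s t = rho_I t s"
proof -
  have "((s - 1) * (t + 1)) / ((s + 1) * (t - 1)) = inverse (((t - 1) * (s + 1)) / ((t + 1) * (s - 1)))"
    by (simp add: mult.commute)
  moreover have "((t - 1) * (s + 1)) / ((t + 1) * (s - 1)) > 0"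
    using assms by (simp add: zero_less_divide_iff zero_less_mult_iff mult_less_0_iff)
  ultimately show ?thesis unfolding rho_I_def by (simp add: ln_inverse del: inverse_divide)
qed

lemma rho_I_minus: "rho_I (- t) (- s) = rho_I s t"
proof -
  have "((- t - 1) * (- s + 1)) = ((s - 1) * (t + 1))" "((- t + 1) * (- s - 1)) = ((s + 1) * (t - 1))"
    by (simp_all add: algebra_simps)
  then show ?thesis unfolding rho_I_def by simp
qed

lemma markowitz_sums_nonneg: "r \<in> markowitz_sums \<Omega> x y \<Longrightarrow> 0 \<le> r"
  unfolding markowitz_sums_def by (auto intro!: sum_nonneg)

lemma bdd_below_markowitz_sums: "bdd_below (markowitz_sums \<Omega> x y)"
  using markowitz_sums_nonneg unfolding bdd_below_def by blast

lemma bdd_below_null_sums: "bdd_below (null_sums \<Omega> T x y)"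
  unfolding bdd_below_def null_sums_def by (auto intro!: exI[of _ 0] sum_nonneg)

lemma markowitz_distance_le: "r \<in> markowitz_sums \<Omega> x y \<Longrightarrow> markowitz_distance \<Omega> x y \<le> r"
  unfolding markowitz_distance_eq by (rule cInf_lower[OF _ bdd_below_markowitz_sums])

lemma rho_I_in_markowitz_sums:
  assumes "projective_lightlike_geodesic \<Omega> \<gamma>" "s \<in> {-1<..<1}" "t \<in> {-1<..<1}"
  shows "rho_I s t \<in> markowitz_sums \<Omega> (\<gamma> s) (\<gamma> t)"
  unfolding markowitz_sums_def mem_Collect_eq
  by (rule exI[of _ 1], rule exI[of _ "\<lambda>_. \<gamma>"], rule exI[of _ "\<lambda>_. s"], rule exI[of _ "\<lambda>_. t"])
    (use assms in auto)

lemma markowitz_sums_add: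
  assumes "r \<in> markowitz_sums \<Omega> x y" "r' \<in> markowitz_sums \<Omega> y z"
  shows "r + r' \<in> markowitz_sums \<Omega> x z"
proof -
  obtain m \<gamma> s t where 1: "r = (\<Sum>k=1..m. rho_I (s k) (t k))" "1 \<le> m"
    "\<forall>k\<in>{1..m}. projective_lightlike_geodesic \<Omega> (\<gamma> k) \<and> s k \<in> {-1<..<1} \<and> t k \<in> {-1<..<1}"
    "\<gamma> 1 (s 1) = x" "\<gamma> m (t m) = y" "\<forall>k\<in>{1..<m}. \<gamma> k (t k) = \<gamma> (Suc k) (s (Suc k))"
    using assms(1) unfolding markowitz_sums_def by auto
  obtain m' \<gamma>' s' t' where 2: "r' = (\<Sum>k=1..m'. rho_I (s' k) (t' k))" "1 \<le> m'"
    "\<forall>k\<in>{1..m'}. projective_lightlike_geodesic \<Omega> (\<gamma>' k) \<and> s' k \<in> {-1<..<1} \<and> t' k \<in> {-1<..<1}"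
    "\<gamma>' 1 (s' 1) = y" "\<gamma>' m' (t' m') = z" "\<forall>k\<in>{1..<m'}. \<gamma>' k (t' k) = \<gamma>' (Suc k) (s' (Suc k))"
    using assms(2) unfolding markowitz_sums_def by auto
  define g where "g k = (if k \<le> m then \<gamma> k else \<gamma>' (k - m))" for k
  define S where "S k = (if k \<le> m then s k else s' (k - m))" for k
  define U where "U k = (if k \<le> m then t k else t' (k - m))" for k
  have "(\<Sum>k=1..m + m'. rho_I (S k) (U k))
      = (\<Sum>k=1..m. rho_I (S k) (U k)) + (\<Sum>k=m+1..m + m'. rho_I (S k) (U k))"
    by (rule sum.ub_add_nat) simp
  also have "(\<Sum>k=1..m. rho_I (S k) (U k)) = r"
    unfolding 1(1) by (rule sum.cong) (auto simp: S_def U_def)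
  also have "(\<Sum>k=m+1..m + m'. rho_I (S k) (U k)) = (\<Sum>k=1..m'. rho_I (S (k + m)) (U (k + m)))"
    using sum.shift_bounds_cl_nat_ivl[of "\<lambda>k. rho_I (S k) (U k)" 1 m m'] by (simp add: add.commute)
  also have "\<dots> = r'"
    unfolding 2(1) by (rule sum.cong) (auto simp: S_def U_def)
  finally have "r + r' = (\<Sum>k=1..m + m'. rho_I (S k) (U k))" by simp
  moreover have "\<forall>k\<in>{1..m + m'}. projective_lightlike_geodesic \<Omega> (g k) \<and> S k \<in> {-1<..<1} \<and> U k \<in> {-1<..<1}"
  proof
    fix k assume k: "k \<in> {1..m + m'}"
    show "projective_lightlike_geodesic \<Omega> (g k) \<and> S k \<in> {-1<..<1} \<and> U k \<in> {-1<..<1}"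
    proof (cases "k \<le> m")
      case True
      then show ?thesis using 1(3) k by (simp add: g_def S_def U_def)
    next
      case False
      then have "k - m \<in> {1..m'}" using k by auto
      then show ?thesis using 2(3) False by (simp add: g_def S_def U_def)
    qed
  qed
  moreover have "\<forall>k\<in>{1..<m + m'}. g k (U k) = g (Suc k) (S (Suc k))"
  proof
    fix k assume k: "k \<in> {1..<m + m'}"
    consider "k < m" | "k = m" | "k > m" by linarith
    then show "g k (U k) = g (Suc k) (S (Suc k))"
    proof cases
      case 1
      then show ?thesis using \<open>\<forall>k\<in>{1..<m}. \<gamma> k (t k) = _\<close> k by (simp add: g_def S_def U_def)
    next
      case 2
      then show ?thesis using 1(5) \<open>\<gamma>' 1 (s' 1) = y\<close> by (simp add: g_def S_def U_def)
    next
      case 3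
      then have "k - m \<in> {1..<m'}" "Suc k - m = Suc (k - m)" using k by auto
      then show ?thesis using 2(6) 3 by (simp add: g_def S_def U_def)
    qed
  qed
  moreover have "1 \<le> m + m'" "g 1 (S 1) = x" "g (m + m') (U (m + m')) = z"
    using 1 2 by (auto simp: g_def S_def U_def)
  ultimately show ?thesis unfolding markowitz_sums_def mem_Collect_eq by blast
qed

text \<open>A real infimum carries information only over a nonempty set, so existence of chains is
  propagated together with the inequality.\<close>

lemma markowitz_distance_triangle:
  assumes "markowitz_sums \<Omega> x y \<noteq> {}" "markowitz_sums \<Omega> y z \<noteq> {}"
  shows "markowitz_sums \<Omega> x z \<noteq> {}"
    and "markowitz_distance \<Omega> x z \<le> markowitz_distance \<Omega> x y + markowitz_distance \<Omega> y z"
proof -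
  show "markowitz_sums \<Omega> x z \<noteq> {}" using assms markowitz_sums_add by blast
  have 1: "markowitz_distance \<Omega> x z - r' \<le> markowitz_distance \<Omega> x y"
    if "r' \<in> markowitz_sums \<Omega> y z" for r'
    unfolding markowitz_distance_eq[of \<Omega> x y] using assms(1)
  proof (rule cInf_greatest)
    fix r assume "r \<in> markowitz_sums \<Omega> x y"
    then have "markowitz_distance \<Omega> x z \<le> r + r'"
      using that markowitz_sums_add markowitz_distance_le by blast
    then show "markowitz_distance \<Omega> x z - r' \<le> r" by simp
  qed
  have "markowitz_distance \<Omega> x z - markowitz_distance \<Omega> x y \<le> markowitz_distance \<Omega> y z"
    unfolding markowitz_distance_eq[of \<Omega> y z] using assms(2)
    by (rule cInf_greatest) (use 1 in fastforce)
  then show "markowitz_distance \<Omega> x z \<le> markowitz_distance \<Omega> x y + markowitz_distance \<Omega> y z" by simp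
qed

lemma geodesic_causal:
  assumes "projective_lightlike_geodesic \<Omega> \<gamma>" "s \<in> {-1<..<1}" "t \<in> {-1<..<1}"
  shows "\<gamma> t - \<gamma> s \<in> light_cone \<or> \<gamma> s - \<gamma> t \<in> light_cone"
proof -
  obtain x v a b c d where v: "lightlike v"
    and \<gamma>: "\<And>s. s \<in> {-1<..<1} \<Longrightarrow> \<gamma> s = x + ((a * s + b) / (c * s + d)) *\<^sub>R v"
    using assms(1) unfolding projective_lightlike_geodesic_def by metis
  define k where "k = (a * t + b) / (c * t + d) - (a * s + b) / (c * s + d)"
  have k: "\<gamma> t - \<gamma> s = k *\<^sub>R v" "\<gamma> s - \<gamma> t = (- k) *\<^sub>R v"
    "\<gamma> t - \<gamma> s = (- k) *\<^sub>R (- v)" "\<gamma> s - \<gamma> t = k *\<^sub>R (- v)"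
    using \<gamma>[OF assms(2)] \<gamma>[OF assms(3)] by (simp_all add: k_def algebra_simps)
  from lightlike_cases[OF v] show ?thesis
  proof
    assume "v \<in> light_cone"
    then show ?thesis
      using light_cone_scaleR[of v k] light_cone_scaleR[of v "- k"] k(1,2) by (cases "k \<ge> 0") auto
  next
    assume "- v \<in> light_cone"
    then show ?thesis
      using light_cone_scaleR[of "- v" k] light_cone_scaleR[of "- v" "- k"] k(3,4)
      by (cases "k \<ge> 0") auto
  qed
qed

lemma geodesic_in_domain:
  "projective_lightlike_geodesic \<Omega> \<gamma> \<Longrightarrow> s \<in> {-1<..<1} \<Longrightarrow> \<gamma> s \<in> \<Omega>"
  unfolding projective_lightlike_geodesic_def by blast

text \<open>The two points used on each geodesic lie on one lightlike line and are therefore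
  causally related, so a Markowitz chain is also a chain for the null distance.\<close>

lemma null_sum_le_markowitz_sum:
  assumes T: "\<And>\<gamma> s t. projective_lightlike_geodesic \<Omega> \<gamma> \<Longrightarrow> s \<in> {-1<..<1} \<Longrightarrow> t \<in> {-1<..<1} \<Longrightarrow>
      c * \<bar>T (\<gamma> t) - T (\<gamma> s)\<bar> \<le> rho_I s t"
    and r: "r \<in> markowitz_sums \<Omega> x y"
  obtains r' where "r' \<in> null_sums \<Omega> T x y" "c * r' \<le> r"
proof -
  obtain m \<gamma> s t where 1: "r = (\<Sum>k=1..m. rho_I (s k) (t k))" "1 \<le> m"
    "\<forall>k\<in>{1..m}. projective_lightlike_geodesic \<Omega> (\<gamma> k) \<and> s k \<in> {-1<..<1} \<and> t k \<in> {-1<..<1}"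
    "\<gamma> 1 (s 1) = x" "\<gamma> m (t m) = y" "\<forall>k\<in>{1..<m}. \<gamma> k (t k) = \<gamma> (Suc k) (s (Suc k))"
    using r unfolding markowitz_sums_def mem_Collect_eq by blast
  note 13 = bspec[OF 1(3)]
  \<comment> \<open>\<open>m\<close> geodesics have \<open>m + 1\<close> nodes: the starting points,
    and \<open>y\<close> at index \<open>m + 1\<close>.\<close>
  define z where "z k = (if k \<le> m then \<gamma> k (s k) else y)" for k
  have z: "z k = \<gamma> k (s k)" "z (Suc k) = \<gamma> k (t k)" if "k \<in> {1..m}" for k
    using that 1(5,6) by (cases "k = m"; force simp: z_def)+
  define r' where "r' = (\<Sum>k=1..<Suc m. \<bar>T (z (Suc k)) - T (z k)\<bar>)"
  have zO: "z k \<in> \<Omega>" if "k \<in> {1..Suc m}" for k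
  proof (cases "k \<le> m")
    case True
    then show ?thesis using that z(1)[of k] 13[of k] geodesic_in_domain by auto
  next
    case False
    then have "k = Suc m" using that by auto
    then show ?thesis using z(2)[of m] 1(2) 13[of m] geodesic_in_domain by auto
  qed
  have rel: "causally_related (z k) (z (Suc k))" if k: "k \<in> {1..m}" for k
    using geodesic_causal[of \<Omega> "\<gamma> k" "s k" "t k"] 13[OF k] z[OF k]
    unfolding causally_related_def causal_le_iff by (metis light_cone_subset_causal_cone)
  have "r' \<in> null_sums \<Omega> T x y"
    unfolding null_sums_def mem_Collect_eq r'_def
    by (rule exI[of _ "Suc m"], rule exI[of _ z])
      (use zO rel 1(2,4) in \<open>auto simp: z_def less_Suc_eq_le\<close>)
  moreover have "c * r' = (\<Sum>k=1..m. c * \<bar>T (z (Suc k)) - T (z k)\<bar>)"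
    unfolding r'_def by (simp add: atLeastLessThanSuc_atLeastAtMost sum_distrib_left)
  then have "c * r' \<le> r"
    unfolding 1(1) using T 13 z by (auto intro!: sum_mono)
  ultimately show thesis by (rule that)
qed

lemma null_sum_ge:
  assumes "r \<in> null_sums \<Omega> T x y"
  shows "\<bar>T y - T x\<bar> \<le> r"
proof -
  obtain m z where r: "r = (\<Sum>k=1..<m. \<bar>T (z (Suc k)) - T (z k)\<bar>)" "1 \<le> m" "z 1 = x" "z m = y"
    using assms unfolding null_sums_def by blast
  have "T y - T x = (\<Sum>k=1..<m. T (z (Suc k)) - T (z k))"
    using sum_Suc_diff'[of 1 m "\<lambda>k. T (z k)"] r(2-4) by simp
  then show ?thesis unfolding r(1) by (simp add: sum_abs)
qed

lemma null_sum_single: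
  assumes "x \<in> \<Omega>" "y \<in> \<Omega>" "y - x \<in> causal_cone"
  shows "\<bar>T y - T x\<bar> \<in> null_sums \<Omega> T x y"
  unfolding null_sums_def mem_Collect_eq
  by (rule exI[of _ 2], rule exI[of _ "\<lambda>k. if k = 1 then x else y"])
    (use assms in \<open>auto simp: causally_related_def causal_le_iff numeral_2_eq_2\<close>)

lemma null_distance_causal:
  assumes "x \<in> \<Omega>" "y \<in> \<Omega>" "y - x \<in> causal_cone"
  shows "null_distance \<Omega> T x y = \<bar>T y - T x\<bar>"
  unfolding null_distance_eq
  by (rule cInf_eq_minimum[OF null_sum_single[OF assms] null_sum_ge])

text \<open>Moving \<open>x\<close> far enough up in time gives a common causal future
  \<open>w\<close> of \<open>x\<close> and \<open>y\<close>, and \<open>x, w, y\<close> is a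
  chain.\<close>

lemma null_sums_nonempty:
  fixes \<Omega> :: "'n::finite minkowski set"
  assumes add: "\<And>x v. x \<in> \<Omega> \<Longrightarrow> v \<in> causal_cone \<Longrightarrow> x + v \<in> \<Omega>" and "x \<in> \<Omega>" "y \<in> \<Omega>"
  shows "null_sums \<Omega> T x y \<noteq> {}"
proof -
  obtain s where s: "s > 0" "(x - y) + s *\<^sub>R time_vector \<in> (chron_cone :: 'n minkowski set)"
    using chron_cone_absorbs[OF time_vector_in_chron_cone, of "x - y"] by blast
  define w where "w = x + s *\<^sub>R (time_vector :: 'n minkowski)"
  have wx: "w - x \<in> causal_cone"
    using s(1) unfolding w_def
    by (simp add: causal_cone_scaleR chron_cone_subset_causal_cone time_vector_in_chron_cone)
  have wy: "w - y \<in> causal_cone"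
    using chron_cone_subset_causal_cone[OF s(2)] by (simp add: w_def algebra_simps)
  have w: "w \<in> \<Omega>" using add[OF assms(2) wx] by simp
  define z where "z k = (if k = (1::nat) then x else if k = 2 then w else y)" for k
  have "(\<Sum>k=1..<3. \<bar>T (z (Suc k)) - T (z k)\<bar>) \<in> null_sums \<Omega> T x y"
    unfolding null_sums_def mem_Collect_eq
    by (rule exI[of _ 3], rule exI[of _ z])
      (use assms w wx wy in \<open>auto simp: causally_related_def causal_le_iff z_def\<close>)
  then show ?thesis by blast
qed

lemma markowitz_le_null_sum:
  assumes step: "\<And>x y. x \<in> \<Omega> \<Longrightarrow> y \<in> \<Omega> \<Longrightarrow> causally_related x y \<Longrightarrow>
      markowitz_sums \<Omega> x y \<noteq> {} \<and> markowitz_distance \<Omega> x y \<le> c * \<bar>T y - T x\<bar>"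
    and r: "r \<in> null_sums \<Omega> T x y"
  shows "markowitz_sums \<Omega> x y \<noteq> {} \<and> markowitz_distance \<Omega> x y \<le> c * r"
proof -
  obtain m z where 1: "r = (\<Sum>k=1..<m. \<bar>T (z (Suc k)) - T (z k)\<bar>)" "1 \<le> m" "z 1 = x" "z m = y"
    "\<And>k. k \<in> {1..m} \<Longrightarrow> z k \<in> \<Omega>" "\<And>k. k \<in> {1..<m} \<Longrightarrow> causally_related (z k) (z (Suc k))"
    using r unfolding null_sums_def by blast
  have "markowitz_sums \<Omega> x (z (Suc n)) \<noteq> {} \<and>
      markowitz_distance \<Omega> x (z (Suc n)) \<le> c * (\<Sum>k=1..<Suc n. \<bar>T (z (Suc k)) - T (z k)\<bar>)"
    if "Suc n \<le> m" for n
    using that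
  proof (induction n)
    case 0
    \<comment> \<open>For a chain of one node the sum is empty; the trivial pair \<open>x, x\<close>
      still supplies a Markowitz chain and distance at most 0.\<close>
    then show ?case
      using step[of x x] 1(3) 1(5)[of 1] by (simp add: causally_related_def causal_le_iff)
  next
    case (Suc n)
    have IH: "markowitz_sums \<Omega> x (z (Suc n)) \<noteq> {}"
      "markowitz_distance \<Omega> x (z (Suc n)) \<le> c * (\<Sum>k=1..<Suc n. \<bar>T (z (Suc k)) - T (z k)\<bar>)"
      using Suc by auto
    have st: "markowitz_sums \<Omega> (z (Suc n)) (z (Suc (Suc n))) \<noteq> {}"
      "markowitz_distance \<Omega> (z (Suc n)) (z (Suc (Suc n))) \<le> c * \<bar>T (z (Suc (Suc n))) - T (z (Suc n))\<bar>"
      using step[of "z (Suc n)" "z (Suc (Suc n))"] 1(5)[of "Suc n"] 1(5)[of "Suc (Suc n)"]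
        1(6)[of "Suc n"] Suc.prems by auto
    show ?case
      using markowitz_distance_triangle[OF IH(1) st(1)] IH(2) st(2) by (simp add: distrib_left)
  qed
  from this[of "m - 1"] show ?thesis using 1 by simp
qed

section \<open>Logarithmic bounds along light rays\<close>

text \<open>A root \<open>- d / c\<close> outside the open interval forces
  \<open>\<bar>c\<bar> \<le> \<bar>d\<bar>\<close>, so the denominator keeps the sign of
  \<open>d\<close>. At the end point it may vanish, since a pole there is allowed.\<close>

lemma affine_nonvanishing:
  fixes c d :: real
  assumes nz: "\<And>s. s \<in> {-1<..<1} \<Longrightarrow> c * s + d \<noteq> 0" and p: "p \<in> {-1<..<1}"
  shows "0 < d * (c * p + d)" "0 \<le> d * (c + d)"
proof -
  have d: "d \<noteq> 0" using nz[of 0] by simp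
  have cd: "\<bar>c\<bar> \<le> \<bar>d\<bar>"
  proof (rule ccontr)
    assume "\<not> \<bar>c\<bar> \<le> \<bar>d\<bar>"
    then have "\<bar>- d / c\<bar> < 1" "c \<noteq> 0" by (auto simp: abs_divide)
    then have "- d / c \<in> {-1<..<1}" unfolding abs_less_iff greaterThanLessThan_iff by linarith
    then show False using nz[of "- d / c"] \<open>c \<noteq> 0\<close> by simp
  qed
  have "\<bar>d * (c * p)\<bar> = \<bar>d\<bar> * \<bar>c\<bar> * \<bar>p\<bar>" by (simp add: abs_mult)
  also have "\<dots> \<le> \<bar>d\<bar> * \<bar>d\<bar> * \<bar>p\<bar>" using cd by (intro mult_right_mono mult_left_mono) auto
  also have "\<dots> < \<bar>d\<bar> * \<bar>d\<bar> * 1" 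
  proof (rule mult_strict_left_mono)
    show "\<bar>p\<bar> < 1" using p by auto
    show "0 < \<bar>d\<bar> * \<bar>d\<bar>" using d by (intro mult_pos_pos) auto
  qed
  finally have "\<bar>d * (c * p)\<bar> < d * d" by simp
  then show "0 < d * (c * p + d)" by (simp add: distrib_left abs_less_iff)
  have "\<bar>d * c\<bar> \<le> \<bar>d\<bar> * \<bar>d\<bar>" unfolding abs_mult using cd by (intro mult_left_mono) auto
  then show "0 \<le> d * (c + d)" by (simp add: distrib_left abs_le_iff)
qed

text \<open>The conditions hold for instance if \<open>F\<close> is positive and concave. They make \<open>ln \<circ> F\<close>
  1-Lipschitz for the Markowitz pseudodistance.\<close>

locale lightlike_star_function =
  fixes \<Omega> :: "'n::finite minkowski set" and F :: "'n minkowski \<Rightarrow> real"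
  assumes F_pos: "x \<in> \<Omega> \<Longrightarrow> F x > 0"
    and F_mono: "x \<in> \<Omega> \<Longrightarrow> u \<in> light_cone \<Longrightarrow> F x \<le> F (x + u)"
    and F_star: "\<lbrakk>b \<in> \<Omega>; b + u \<in> \<Omega>; u \<in> light_cone; 0 < c; c \<le> 1\<rbrakk> \<Longrightarrow> c * F (b + u) \<le> F (b + c *\<^sub>R u)"
begin

text \<open>For \<open>p < s < t\<close>, \<open>F_star\<close> based at \<open>\<gamma> p\<close>
  compares \<open>F\<close> at \<open>\<gamma> s\<close> and \<open>\<gamma> t\<close>. As
  \<open>p\<close> tends to -1 the bound becomes the factor of the cross-ratio at the past end,
  times a quotient of denominators; that quotient is absorbed by the factor at the other
  end.\<close>

lemma log_bound_future:
  assumes geo: "projective_lightlike_geodesic \<Omega> \<gamma>"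
    and s: "s \<in> {-1<..<1}" and t: "t \<in> {-1<..<1}" and st: "s < t"
    and fut: "\<gamma> t - \<gamma> s \<in> light_cone"
  shows "\<bar>ln (F (\<gamma> t)) - ln (F (\<gamma> s))\<bar> \<le> rho_I s t"
proof -
  obtain x v a b c d where det: "a * d - b * c \<noteq> 0"
    and nz: "\<And>s. s \<in> {-1<..<1} \<Longrightarrow> c * s + d \<noteq> 0"
    and \<gamma>: "\<And>s. s \<in> {-1<..<1} \<Longrightarrow> \<gamma> s = x + ((a * s + b) / (c * s + d)) *\<^sub>R v"
    using geo unfolding projective_lightlike_geodesic_def by metis
  \<comment> \<open>The denominator of the homography, normalised to be positive.\<close>
  define E where "E p = d * (c * p + d)" for p
  have E: "0 < E p" if "p \<in> {-1<..<1}" for p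
    using affine_nonvanishing(1)[OF nz that] by (simp add: E_def)
  have E1: "0 \<le> E 1" using affine_nonvanishing(2)[OF nz s] by (simp add: E_def)
  have d: "d \<noteq> 0" using nz[of 0] by simp
  have diff: "\<gamma> q - \<gamma> p = ((a * d - b * c) * d\<^sup>2 * (q - p) / (E q * E p)) *\<^sub>R v"
    if "p \<in> {-1<..<1}" "q \<in> {-1<..<1}" for p q
  proof -
    have "(a * q + b) / (c * q + d) - (a * p + b) / (c * p + d)
        = ((a * d - b * c) * (q - p)) / ((c * q + d) * (c * p + d))"
      using nz[OF that(1)] nz[OF that(2)] by (simp add: diff_frac_eq algebra_simps)
    also have "\<dots> = (a * d - b * c) * d\<^sup>2 * (q - p) / (E q * E p)"
      using d by (simp add: E_def power2_eq_square)
    finally show ?thesis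
      unfolding \<gamma>[OF that(1)] \<gamma>[OF that(2)] by (simp flip: scaleR_diff_left)
  qed
  have key: "(s - p) * E t * F (\<gamma> t) \<le> (t - p) * E s * F (\<gamma> s)" if p: "-1 < p" "p < s" for p
  proof -
    have pI: "p \<in> {-1<..<1}" using p s by auto
    \<comment> \<open>\<open>l\<close> locates \<open>\<gamma> s\<close> on the segment from
      \<open>\<gamma> p\<close> to \<open>\<gamma> t\<close>; \<open>m\<close> rescales
      \<open>\<gamma> t - \<gamma> s\<close> to \<open>\<gamma> t - \<gamma> p\<close> and transfers
      its future direction.\<close>
    define l where "l = (s - p) * E t / ((t - p) * E s)"
    define m where "m = (t - p) * E s / ((t - s) * E p)"
    have l: "l > 0" and m: "m > 0"
      using p st E[OF s] E[OF t] E[OF pI] by (auto simp: l_def m_def)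
    have "\<gamma> t - \<gamma> p = m *\<^sub>R (\<gamma> t - \<gamma> s)"
      unfolding diff[OF pI t] diff[OF s t] scaleR_scaleR using E[OF s] E[OF t] E[OF pI] st p
      by (simp add: m_def field_simps)
    then have ulc: "\<gamma> t - \<gamma> p \<in> light_cone" using fut m by (simp add: light_cone_scaleR)
    have sp: "\<gamma> s - \<gamma> p = l *\<^sub>R (\<gamma> t - \<gamma> p)"
      unfolding diff[OF pI t] diff[OF pI s] scaleR_scaleR using E[OF s] E[OF t] E[OF pI] st p
      by (simp add: l_def field_simps)
    have "E s * (t - p) - E t * (s - p) = (t - s) * E p"
      by (simp add: E_def algebra_simps)
    moreover have "0 \<le> (t - s) * E p" using st E[OF pI] by simp
    ultimately have "(s - p) * E t \<le> (t - p) * E s" by (simp add: mult.commute)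
    then have "l \<le> 1" using p st E[OF s] by (simp add: l_def)
    then have "l * F (\<gamma> p + (\<gamma> t - \<gamma> p)) \<le> F (\<gamma> p + l *\<^sub>R (\<gamma> t - \<gamma> p))"
      using geodesic_in_domain[OF geo pI] geodesic_in_domain[OF geo t] ulc l by (intro F_star) auto
    then have "l * F (\<gamma> t) \<le> F (\<gamma> s)" by (simp flip: sp)
    then show ?thesis using p st E[OF s] by (simp add: l_def field_simps)
  qed
  \<comment> \<open>Let \<open>\<gamma> p\<close> tend to the past end of the geodesic.\<close>
  have "((\<lambda>p. (s - p) * E t * F (\<gamma> t)) \<longlongrightarrow> (s - (-1)) * E t * F (\<gamma> t)) (at_right (-1))"
    "((\<lambda>p. (t - p) * E s * F (\<gamma> s)) \<longlongrightarrow> (t - (-1)) * E s * F (\<gamma> s)) (at_right (-1))"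
    by (intro tendsto_intros)+
  moreover have "\<forall>\<^sub>F p in at_right (-1). (s - p) * E t * F (\<gamma> t) \<le> (t - p) * E s * F (\<gamma> s)"
    using s key by (auto simp: eventually_at_right_field intro!: exI[of _ s])
  ultimately have "(s - (-1)) * E t * F (\<gamma> t) \<le> (t - (-1)) * E s * F (\<gamma> s)"
    by (intro tendsto_le[OF trivial_limit_at_right_real]) auto
  then have 1: "(s + 1) * E t * F (\<gamma> t) \<le> (t + 1) * E s * F (\<gamma> s)" by simp
  \<comment> \<open>\<open>E\<close> is affine, so this combination depends only on its value at 1,
    which is nonnegative because no pole lies inside the interval.\<close>
  have "E t * (1 - s) - E s * (1 - t) = (t - s) * E 1" by (simp add: E_def algebra_simps)
  moreover have "0 \<le> (t - s) * E 1" using st E1 by simp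
  ultimately have 2: "E s * (1 - t) \<le> E t * (1 - s)" by simp
  have Fs: "F (\<gamma> s) > 0" and Ft: "F (\<gamma> t) > 0"
    using F_pos geodesic_in_domain[OF geo] s t by auto
  have "(s + 1) * E t * F (\<gamma> t) * (1 - t) \<le> (t + 1) * E s * F (\<gamma> s) * (1 - t)"
    using 1 t by (intro mult_right_mono) auto
  also have "\<dots> = (t + 1) * F (\<gamma> s) * (E s * (1 - t))" by simp
  also have "\<dots> \<le> (t + 1) * F (\<gamma> s) * (E t * (1 - s))"
    using 2 t Fs by (intro mult_left_mono) auto
  finally have "E t * ((s + 1) * (1 - t) * F (\<gamma> t)) \<le> E t * ((t + 1) * (1 - s) * F (\<gamma> s))"
    by (simp add: mult_ac)
  then have "(s + 1) * (1 - t) * F (\<gamma> t) \<le> (t + 1) * (1 - s) * F (\<gamma> s)"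
    using E[OF t] by simp
  moreover have "(s + 1) * (1 - t) > 0" using s t by simp
  ultimately have "F (\<gamma> t) / F (\<gamma> s) \<le> ((t + 1) * (1 - s)) / ((s + 1) * (1 - t))"
    using Fs by (simp add: pos_divide_le_eq pos_le_divide_eq mult_ac)
  also have "\<dots> = (- ((t + 1) * (1 - s))) / (- ((s + 1) * (1 - t)))" by (simp only: minus_divide_divide)
  also have "\<dots> = ((s - 1) * (t + 1)) / ((s + 1) * (t - 1))" by (simp add: algebra_simps)
  finally have ratio: "F (\<gamma> t) / F (\<gamma> s) \<le> ((s - 1) * (t + 1)) / ((s + 1) * (t - 1))" .
  have mono: "F (\<gamma> s) \<le> F (\<gamma> t)"
    using F_mono[OF geodesic_in_domain[OF geo s] fut] by simp
  have "\<bar>ln (F (\<gamma> t)) - ln (F (\<gamma> s))\<bar> = ln (F (\<gamma> t)) - ln (F (\<gamma> s))"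
    using mono Fs by simp
  also have "\<dots> = ln (F (\<gamma> t) / F (\<gamma> s))" using Fs Ft by (simp add: ln_div)
  also have "\<dots> \<le> ln (((s - 1) * (t + 1)) / ((s + 1) * (t - 1)))"
    by (rule ln_mono) (use ratio Fs Ft in auto)
  also have "\<dots> \<le> rho_I s t" by (simp add: rho_I_def)
  finally show ?thesis .
qed

lemma log_bound:
  assumes geo: "projective_lightlike_geodesic \<Omega> \<gamma>"
    and s: "s \<in> {-1<..<1}" and t: "t \<in> {-1<..<1}"
  shows "\<bar>ln (F (\<gamma> t)) - ln (F (\<gamma> s))\<bar> \<le> rho_I s t"
proof -
  have *: "\<bar>ln (F (\<gamma> t)) - ln (F (\<gamma> s))\<bar> \<le> rho_I s t"
    if s: "s \<in> {-1<..<1}" and t: "t \<in> {-1<..<1}" and st: "s < t" for s t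
    using geodesic_causal[OF geo s t]
  proof
    assume "\<gamma> t - \<gamma> s \<in> light_cone"
    then show ?thesis by (rule log_bound_future[OF geo s t st])
  next
    \<comment> \<open>A past directed geodesic is reversed by \<open>s \<mapsto> - s\<close>, which
      changes the signs of \<open>a\<close> and \<open>c\<close>; \<open>rho_I\<close> is
      invariant.\<close>
    assume fut: "\<gamma> s - \<gamma> t \<in> light_cone"
    obtain x v a b c d where g: "lightlike v" "a * d - b * c \<noteq> 0"
      "\<forall>s\<in>{-1<..<1}. c * s + d \<noteq> 0 \<and> \<gamma> s = x + ((a * s + b) / (c * s + d)) *\<^sub>R v \<and> \<gamma> s \<in> \<Omega>"
      using geo unfolding projective_lightlike_geodesic_def by metis
    have g': "c * (- s) + d \<noteq> 0 \<and> \<gamma> (- s) = x + ((a * (- s) + b) / (c * (- s) + d)) *\<^sub>R v \<and> \<gamma> (- s) \<in> \<Omega>"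
      if "s \<in> {-1<..<1}" for s
      using that by (intro bspec[OF g(3)]) auto
    have "- c * s + d \<noteq> 0 \<and> \<gamma> (- s) = x + ((- a * s + b) / (- c * s + d)) *\<^sub>R v \<and> \<gamma> (- s) \<in> \<Omega>"
      if "s \<in> {-1<..<1}" for s
    proof -
      have "- c * s + d = c * (- s) + d" "- a * s + b = a * (- s) + b" by simp_all
      then show ?thesis using g'[OF that] by metis
    qed
    note g'' = this
    have det: "- a * d - b * - c \<noteq> 0" using g(2) by simp
    have "projective_lightlike_geodesic \<Omega> (\<lambda>s. \<gamma> (- s))"
      unfolding projective_lightlike_geodesic_def
      by (rule exI[of _ x], rule exI[of _ v], rule exI[of _ "- a"], rule exI[of _ b],
          rule exI[of _ "- c"], rule exI[of _ d]) (use g(1) det g'' in blast)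
    from log_bound_future[OF this, of "- t" "- s"] show ?thesis
      using s t st fut by (simp add: rho_I_minus)
  qed
  consider "s < t" | "s = t" | "t < s" by linarith
  then show ?thesis
  proof cases
    case 3
    then show ?thesis using *[OF t s] rho_I_commute[OF s t] by (simp add: abs_minus_commute)
  qed (use * s t in auto)
qed

end

text \<open>The homography \<open>h0 * (1 + s) / (1 - s)\<close> maps the interval onto the positive
  half-line, so \<open>\<gamma>\<close> runs from \<open>x - h0 *\<^sub>R u\<close> to infinity with
  \<open>x\<close> at parameter 0. The cross-ratio then is the ratio of affine distances to the past
  end.\<close>

lemma markowitz_segment:
  assumes u: "u \<in> light_cone" "u \<noteq> 0" and h0: "0 < h0" and h: "0 \<le> h"
    and past: "\<And>s. s < h0 \<Longrightarrow> x - s *\<^sub>R u \<in> \<Omega>"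
  shows "ln ((h + h0) / h0) \<in> markowitz_sums \<Omega> x (x + h *\<^sub>R u)"
    and "ln ((h + h0) / h0) \<in> markowitz_sums \<Omega> (x + h *\<^sub>R u) x"
proof -
  define \<gamma> where "\<gamma> s = (x - h0 *\<^sub>R u) + ((h0 * s + h0) / ((- 1) * s + 1)) *\<^sub>R u" for s :: real
  have "\<gamma> s \<in> \<Omega>" if s: "s \<in> {-1<..<1}" for s
  proof -
    have "(h0 * s + h0) = h0 * (s + 1)" by (simp add: algebra_simps)
    then have "(h0 * s + h0) / ((- 1) * s + 1) > 0" using s h0 by simp
    then have "x - (h0 - (h0 * s + h0) / ((- 1) * s + 1)) *\<^sub>R u \<in> \<Omega>" by (intro past) simp
    then show ?thesis by (simp add: \<gamma>_def algebra_simps)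
  qed
  moreover have "h0 * 1 - h0 * (- 1) \<noteq> 0" using h0 by simp
  ultimately have geo: "projective_lightlike_geodesic \<Omega> \<gamma>"
    unfolding projective_lightlike_geodesic_def using light_cone_lightlike[OF u]
    by (intro exI[of _ "x - h0 *\<^sub>R u"] exI[of _ u] exI[of _ h0] exI[of _ "-1"] exI[of _ 1])
      (auto simp: \<gamma>_def)
  \<comment> \<open>The solution of \<open>h0 * (1 + t) / (1 - t) = h + h0\<close>.\<close>
  define t where "t = h / (h + 2 * h0)"
  have t: "t \<in> {-1<..<1}" using h h0 by (auto simp: t_def field_simps)
  have 1: "1 - t = 2 * h0 / (h + 2 * h0)" "t + 1 = 2 * (h + h0) / (h + 2 * h0)"
    using h h0 by (auto simp: t_def field_simps)
  have "\<gamma> 0 = x" by (simp add: \<gamma>_def)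
  moreover have "(h0 * t + h0) / ((- 1) * t + 1) = h + h0"
  proof -
    have "(h0 * t + h0) = h0 * (t + 1)" "(- 1) * t + 1 = 1 - t" by (simp_all add: algebra_simps)
    moreover have "h0 * (2 * (h + h0) / W) / (2 * h0 / W) = h + h0" if "W \<noteq> 0" for W
      using that h0 by (simp add: field_simps)
    moreover have "h + 2 * h0 \<noteq> 0" using h h0 by simp
    ultimately show ?thesis using 1 by metis
  qed
  then have "\<gamma> t = x + h *\<^sub>R u" unfolding \<gamma>_def by (simp add: algebra_simps)
  moreover have "rho_I 0 t = ln ((h + h0) / h0)"
  proof -
    have "((0 - 1) * (t + 1)) / ((0 + 1) * (t - 1)) = (t + 1) / (1 - t)"
      using t by (simp add: field_simps)
    also have "\<dots> = (2 * (h + h0)) / (2 * h0)" unfolding 1 using h h0 by simp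
    also have "\<dots> = (h + h0) / h0" by (rule mult_divide_mult_cancel_left) simp
    finally show ?thesis unfolding rho_I_def using h h0 by simp
  qed
  ultimately show "ln ((h + h0) / h0) \<in> markowitz_sums \<Omega> x (x + h *\<^sub>R u)"
    "ln ((h + h0) / h0) \<in> markowitz_sums \<Omega> (x + h *\<^sub>R u) x"
    using rho_I_in_markowitz_sums[OF geo, of 0 t] rho_I_in_markowitz_sums[OF geo, of t 0] t
      rho_I_commute[OF t, of 0] by auto
qed

section \<open>Comparison of the two distances\<close>

text \<open>A vector of negative square lies in the future or the past cone; its sign against a
  future vector decides which.\<close>

lemma chron_cone_of_mink:
  assumes "mink z z < 0" "mink z u < 0" "u \<in> causal_cone"
  shows "z \<in> chron_cone"
proof (rule ccontr)
  assume z: "z \<notin> chron_cone"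
  have "(norm (snd z))\<^sup>2 < \<bar>fst z\<bar>\<^sup>2" using assms(1) by (simp add: mink_self)
  then have "norm (snd z) < \<bar>fst z\<bar>" by (rule power2_less_imp_less) simp
  then have "- z \<in> causal_cone" using z by (auto simp: chron_cone_def causal_cone_def abs_if split: if_splits)
  then have "mink (- z) u \<le> 0" using mink_causal_nonpos assms(3) by blast
  then show False using assms(2) by (simp add: mink_algebra)
qed

lemma light_cone_of_mink:
  assumes "mink z z = 0" "mink z u < 0" "u \<in> causal_cone"
  shows "z \<in> light_cone"
proof (rule ccontr)
  assume z: "z \<notin> light_cone"
  have "(norm (snd z))\<^sup>2 = \<bar>fst z\<bar>\<^sup>2" using assms(1) by (simp add: mink_self)
  then have "norm (snd z) = \<bar>fst z\<bar>" by (rule power2_eq_imp_eq) auto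
  then have "- z \<in> causal_cone" using z by (auto simp: light_cone_def causal_cone_def abs_if split: if_splits)
  then have "mink (- z) u \<le> 0" using mink_causal_nonpos assms(3) by blast
  then show False using assms(2) by (simp add: mink_algebra)
qed

text \<open>It is enough to test with \<open>(1, e)\<close>, where \<open>e\<close> points along the
  spatial part of \<open>z\<close>: the product is \<open>norm (snd z) - fst z\<close>.\<close>

lemma chron_cone_of_light_cone:
  fixes z :: "'n::finite minkowski"
  assumes "\<And>u. u \<in> light_cone \<Longrightarrow> u \<noteq> 0 \<Longrightarrow> mink z u < 0"
  shows "z \<in> chron_cone"
proof -
  obtain e :: "(real, 'n) vec" where e: "norm e = 1" "snd z = norm (snd z) *\<^sub>R e"
    by (rule direction_exists)
  have "mink z (1, e) < 0" using e(1) by (intro assms) (auto simp: light_cone_def zero_prod_def)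
  moreover have "snd z \<bullet> e = norm (snd z)"
    by (subst e(2)) (use e(1) in \<open>simp add: power2_norm_eq_inner[symmetric]\<close>)
  ultimately show ?thesis by (simp add: mink_def chron_cone_def)
qed

lemma in_closure_of_ray:
  fixes z w :: "'a::real_normed_vector"
  assumes "\<And>e. 0 < e \<Longrightarrow> z + e *\<^sub>R w \<in> S"
  shows "z \<in> closure S"
proof -
  have "((\<lambda>e. z + e *\<^sub>R w) \<longlongrightarrow> z + 0 *\<^sub>R w) (at_right 0)"
    by (intro tendsto_intros)
  moreover have "\<forall>\<^sub>F e in at_right 0. z + e *\<^sub>R w \<in> closure S"
    using assms closure_subset by (auto simp: eventually_at_right_field intro!: exI[of _ 1])
  ultimately have "z + 0 *\<^sub>R w \<in> closure S"
    by (intro Lim_in_closed_set[OF closed_closure]) auto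
  then show ?thesis by simp
qed

text \<open>Since \<open>u\<close> is lightlike, minus the square of
  \<open>x - p - s *\<^sub>R u\<close> is \<open>q - 2 * s * k\<close>, affine in \<open>s\<close>.
  The past ray thus stays in the future of \<open>p\<close> up to \<open>h0 = q / (2 * k)\<close>,
  and \<open>(1 + h0) / h0\<close> is the ratio \<open>(q + 2 * k) / q\<close> of squared distances
  to \<open>p\<close>.\<close>

lemma markowitz_light_step:
  assumes p: "\<And>z. z \<in> chron_cone \<Longrightarrow> p + z \<in> \<Omega>"
    and x: "x - p \<in> chron_cone" and u: "u \<in> light_cone" "u \<noteq> 0"
  defines "r \<equiv> 2 * (ln (lorentz_norm (x + u - p)) - ln (lorentz_norm (x - p)))"
  shows "r \<in> markowitz_sums \<Omega> x (x + u)" "r \<in> markowitz_sums \<Omega> (x + u) x"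
proof -
  define q k where "q = - mink (x - p) (x - p)" and "k = - mink (x - p) u"
  have uc: "u \<in> causal_cone" using u(1) by (rule light_cone_subset_causal_cone)
  have uu: "mink u u = 0" using u(1) by (rule light_cone_mink)
  have q: "q > 0" using chron_cone_mink_neg[OF x] by (simp add: q_def)
  have k: "k > 0" using mink_chron_neg[OF x uc u(2)] by (simp add: k_def)
  define h0 where "h0 = q / (2 * k)"
  have h0: "h0 > 0" using q k by (simp add: h0_def)
  have past: "x - s *\<^sub>R u \<in> \<Omega>" if "s < h0" for s
  proof -
    define z where "z = (x - p) - s *\<^sub>R u"
    have "mink z z = - q + 2 * s * k"
      unfolding z_def mink_diff_self uu q_def k_def by simp
    moreover have "2 * s * k < q" using that k by (simp add: h0_def field_simps)
    moreover have "mink z u = - k" unfolding z_def k_def mink_algebra(2,5) uu by simp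
    ultimately have "z \<in> chron_cone" using k uc by (intro chron_cone_of_mink[of z u]) auto
    then have "p + z \<in> \<Omega>" by (rule p)
    then show ?thesis by (simp add: z_def)
  qed
  have x1: "x + u - p \<in> chron_cone" using chron_cone_add[OF x uc] by (simp add: algebra_simps)
  have n1: "(lorentz_norm (x - p))\<^sup>2 = q"
    using lorentz_norm_sq[OF chron_cone_subset_causal_cone[OF x]] by (simp add: q_def)
  have "x + u - p = (x - p) + 1 *\<^sub>R u" by simp
  then have "mink (x + u - p) (x + u - p) = - (q + 2 * k)"
    by (simp only: mink_add_self uu) (simp add: q_def k_def)
  then have n2: "(lorentz_norm (x + u - p))\<^sup>2 = q + 2 * k"
    using lorentz_norm_sq[OF chron_cone_subset_causal_cone[OF x1]] by simp
  have "r = ln ((lorentz_norm (x + u - p))\<^sup>2) - ln ((lorentz_norm (x - p))\<^sup>2)"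
    unfolding r_def using lorentz_norm_pos[OF x] lorentz_norm_pos[OF x1] by (simp add: ln_realpow)
  also have "\<dots> = ln ((1 + h0) / h0)"
  proof -
    have "(1 + h0) / h0 = (q + 2 * k) / q" using q k by (simp add: h0_def field_simps)
    then show ?thesis unfolding n1 n2 using q k by (simp add: ln_div)
  qed
  finally show "r \<in> markowitz_sums \<Omega> x (x + u)" "r \<in> markowitz_sums \<Omega> (x + u) x"
    using markowitz_segment[OF u h0 zero_le_one past] by auto
qed

context future_convex_domain
begin

text \<open>A chain contains at least one geodesic, so even the trivial chain needs a light ray
  through \<open>x\<close>.\<close>

lemma zero_in_markowitz_sums:
  assumes "x \<in> \<Omega>"
  shows "0 \<in> markowitz_sums \<Omega> x x"
proof -
  obtain u :: "'n minkowski" where u: "u \<in> light_cone" "u \<noteq> 0" by (rule lightlike_exists)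
  obtain h0 where h0: "h0 > 0" "\<And>s. s < h0 \<Longrightarrow> x - s *\<^sub>R u \<in> \<Omega>"
    using past_exit[OF assms light_cone_subset_causal_cone[OF u(1)] u(2)] by blast
  show ?thesis using markowitz_segment(1)[OF u h0(1) order_refl h0(2)] h0(1) by simp
qed

text \<open>A causal displacement is a sum of two lightlike ones, so only lightlike ones matter.\<close>

lemma markowitz_causal_le:
  assumes G: "\<And>x u. x \<in> A \<Longrightarrow> u \<in> light_cone \<Longrightarrow> u \<noteq> 0 \<Longrightarrow>
      G (x + u) - G x \<in> markowitz_sums \<Omega> x (x + u) \<inter> markowitz_sums \<Omega> (x + u) x"
    and A: "A \<subseteq> \<Omega>" "\<And>x u. x \<in> A \<Longrightarrow> u \<in> light_cone \<Longrightarrow> x + u \<in> A"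
    and x: "x \<in> A" and v: "v \<in> causal_cone"
  shows "G (x + v) - G x \<in> markowitz_sums \<Omega> x (x + v) \<inter> markowitz_sums \<Omega> (x + v) x"
proof -
  obtain u w where uw: "u \<in> light_cone" "w \<in> light_cone" "v = u + w"
    using lightlike_decomposition[OF v] by blast
  have step: "G (y + u) - G y \<in> markowitz_sums \<Omega> y (y + u) \<inter> markowitz_sums \<Omega> (y + u) y"
    if "y \<in> A" "u \<in> light_cone" for y u
    using G[OF that] zero_in_markowitz_sums[of y] that A(1) by (cases "u = 0") auto
  have "(G (x + u) - G x) + (G (x + u + w) - G (x + u)) \<in> markowitz_sums \<Omega> x (x + u + w)"
    using step[OF x uw(1)] step[OF A(2)[OF x uw(1)] uw(2)] by (intro markowitz_sums_add) auto
  moreover have "(G (x + u + w) - G (x + u)) + (G (x + u) - G x) \<in> markowitz_sums \<Omega> (x + u + w) x"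
    using step[OF x uw(1)] step[OF A(2)[OF x uw(1)] uw(2)] by (intro markowitz_sums_add) auto
  ultimately show ?thesis by (simp add: uw(3) add.assoc)
qed

abbreviation ltau :: "'n minkowski \<Rightarrow> real" where
  "ltau \<equiv> \<lambda>z. ln (tau z)"

lemma ltau_mono: "x \<in> \<Omega> \<Longrightarrow> v \<in> causal_cone \<Longrightarrow> ltau x \<le> ltau (x + v)"
  using tau_mono tau_pos add_causal by simp

text \<open>The point \<open>r\<close> realising \<open>tau x\<close> is kept fixed through both
  lightlike steps: the distance to it equals \<open>tau\<close> at \<open>x\<close> and is at most
  \<open>tau\<close> at \<open>x + v\<close>, so comparing the ends loses nothing in
  between.\<close>

lemma markowitz_le_causal:
  assumes x: "x \<in> \<Omega>" and v: "v \<in> causal_cone"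
  shows "markowitz_sums \<Omega> x (x + v) \<noteq> {}" "markowitz_sums \<Omega> (x + v) x \<noteq> {}"
    "markowitz_distance \<Omega> x (x + v) \<le> 2 * (ltau (x + v) - ltau x)"
    "markowitz_distance \<Omega> (x + v) x \<le> 2 * (ltau (x + v) - ltau x)"
proof -
  obtain r where r: "r \<in> closure \<Omega>" "x - r \<in> chron_cone" "lorentz_norm (x - r) = tau x"
    by (rule tau_attained[OF x])
  \<comment> \<open>Inside this set the distance to \<open>r\<close> is positive, so its logarithm
    can serve as a potential.\<close>
  define A where "A = {y. y - r \<in> chron_cone}"
  define G where "G y = 2 * ln (lorentz_norm (y - r))" for y
  have rz: "r + z \<in> \<Omega>" if "z \<in> chron_cone" for z using closure_add_chron[OF r(1) that] .
  have *: "G (x + v) - G x \<in> markowitz_sums \<Omega> x (x + v) \<inter> markowitz_sums \<Omega> (x + v) x"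
  proof (rule markowitz_causal_le[of A])
    fix y u :: "'n minkowski" assume "y \<in> A" "u \<in> light_cone" "u \<noteq> 0"
    then show "G (y + u) - G y \<in> markowitz_sums \<Omega> y (y + u) \<inter> markowitz_sums \<Omega> (y + u) y"
      using markowitz_light_step[of r \<Omega> y u, OF rz] by (simp add: A_def G_def right_diff_distrib)
  next
    show "A \<subseteq> \<Omega>" using rz[of "y - r" for y] by (auto simp: A_def)
    show "y + u \<in> A" if "y \<in> A" "u \<in> light_cone" for y u :: "'n minkowski"
      using chron_cone_add[of "y - r" u] that light_cone_subset_causal_cone[of u]
      by (simp add: A_def algebra_simps)
  qed (use r v in \<open>auto simp: A_def\<close>)
  then show "markowitz_sums \<Omega> x (x + v) \<noteq> {}" "markowitz_sums \<Omega> (x + v) x \<noteq> {}" by auto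
  have c: "x + v - r \<in> chron_cone" using chron_cone_add[OF r(2) v] by (simp add: algebra_simps)
  then have "ln (lorentz_norm (x + v - r)) \<le> ltau (x + v)"
    using lorentz_norm_le_tau_closure[OF add_causal[OF x v] r(1)] lorentz_norm_pos[OF c]
    by (intro ln_mono) (auto intro: chron_cone_subset_causal_cone)
  then have "G (x + v) - G x \<le> 2 * (ltau (x + v) - ltau x)" by (simp add: G_def r(3))
  then show "markowitz_distance \<Omega> x (x + v) \<le> 2 * (ltau (x + v) - ltau x)"
    "markowitz_distance \<Omega> (x + v) x \<le> 2 * (ltau (x + v) - ltau x)"
    using markowitz_distance_le * by (meson IntD1 IntD2 order_trans)+
qed

text \<open>The factor is a parameter: \<open>c = 2\<close> gives the general inequality,
  \<open>c = 1\<close> the case of a hyperplane.\<close>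

lemma markowitz_le_null:
  assumes c: "c > 0"
    and step: "\<And>x v. x \<in> \<Omega> \<Longrightarrow> v \<in> causal_cone \<Longrightarrow>
      markowitz_distance \<Omega> x (x + v) \<le> c * (ltau (x + v) - ltau x) \<and>
      markowitz_distance \<Omega> (x + v) x \<le> c * (ltau (x + v) - ltau x)"
    and xy: "x \<in> \<Omega>" "y \<in> \<Omega>"
  shows "markowitz_sums \<Omega> x y \<noteq> {}"
    "markowitz_distance \<Omega> x y \<le> c * null_distance \<Omega> ltau x y"
proof -
  have "markowitz_sums \<Omega> x y \<noteq> {} \<and> markowitz_distance \<Omega> x y \<le> c * \<bar>ltau y - ltau x\<bar>"
    if xy: "x \<in> \<Omega>" "y \<in> \<Omega>" "causally_related x y" for x y
    using xy(3) unfolding causally_related_def causal_le_iff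
  proof
    assume v: "y - x \<in> causal_cone"
    then show ?thesis
      using markowitz_le_causal(1)[OF xy(1) v] step[OF xy(1) v] ltau_mono[OF xy(1) v] by simp
  next
    assume v: "x - y \<in> causal_cone"
    then show ?thesis
      using markowitz_le_causal(2)[OF xy(2) v] step[OF xy(2) v] ltau_mono[OF xy(2) v] by simp
  qed
  note 1 = markowitz_le_null_sum[where T = ltau and c = c, OF this]
  have ne: "null_sums \<Omega> ltau x y \<noteq> {}"
    by (rule null_sums_nonempty[OF add_causal xy])
  then show "markowitz_sums \<Omega> x y \<noteq> {}" using 1 by blast
  have "markowitz_distance \<Omega> x y / c \<le> null_distance \<Omega> ltau x y"
    unfolding null_distance_eq using ne
    by (rule cInf_greatest) (use 1 c in \<open>auto simp: pos_divide_le_eq mult.commute\<close>)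
  then show "markowitz_distance \<Omega> x y \<le> c * null_distance \<Omega> ltau x y"
    using c by (simp add: pos_divide_le_eq mult.commute)
qed

lemma markowitz_sums_nonempty: "x \<in> \<Omega> \<Longrightarrow> y \<in> \<Omega> \<Longrightarrow> markowitz_sums \<Omega> x y \<noteq> {}"
  using markowitz_le_null(1)[of 2] markowitz_le_causal(3,4) by simp

lemma markowitz_le_two_null:
  "x \<in> \<Omega> \<Longrightarrow> y \<in> \<Omega> \<Longrightarrow> markowitz_distance \<Omega> x y \<le> 2 * null_distance \<Omega> ltau x y"
  using markowitz_le_null(2)[of 2] markowitz_le_causal(3,4) by simp

text \<open>Here \<open>c = 1\<close> gives the general lower bound and \<open>c = 2\<close> the
  sharper one for the future of a point.\<close>

lemma null_le_markowitz:
  assumes c: "c > 0"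
    and T: "\<And>\<gamma> s t. projective_lightlike_geodesic \<Omega> \<gamma> \<Longrightarrow> s \<in> {-1<..<1} \<Longrightarrow> t \<in> {-1<..<1} \<Longrightarrow>
      c * \<bar>T (\<gamma> t) - T (\<gamma> s)\<bar> \<le> rho_I s t"
    and xy: "x \<in> \<Omega>" "y \<in> \<Omega>"
  shows "c * null_distance \<Omega> T x y \<le> markowitz_distance \<Omega> x y"
  unfolding markowitz_distance_eq using markowitz_sums_nonempty[OF xy]
proof (rule cInf_greatest)
  fix r assume "r \<in> markowitz_sums \<Omega> x y"
  then obtain r' where r': "r' \<in> null_sums \<Omega> T x y" "c * r' \<le> r"
    using null_sum_le_markowitz_sum[of \<Omega> c T r x y] T by blast
  have "null_distance \<Omega> T x y \<le> r'"
    unfolding null_distance_eq by (rule cInf_lower[OF r'(1) bdd_below_null_sums])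
  then show "c * null_distance \<Omega> T x y \<le> r" using r'(2) c by (meson less_imp_le mult_left_mono order_trans)
qed

sublocale tau: lightlike_star_function \<Omega> tau
  by unfold_locales (auto intro: tau_pos tau_mono tau_homothety light_cone_subset_causal_cone)

lemma null_le_markowitz_ltau:
  "x \<in> \<Omega> \<Longrightarrow> y \<in> \<Omega> \<Longrightarrow> null_distance \<Omega> ltau x y \<le> markowitz_distance \<Omega> x y"
  using null_le_markowitz[of 1 ltau x y] tau.log_bound by simp

lemma star_function_le_markowitz:
  assumes "lightlike_star_function \<Omega> F" "x \<in> \<Omega>" "y \<in> \<Omega>"
  shows "\<bar>ln (F y) - ln (F x)\<bar> \<le> markowitz_distance \<Omega> x y"
proof -
  interpret lightlike_star_function \<Omega> F by (rule assms(1))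
  have "\<bar>ln (F y) - ln (F x)\<bar> \<le> null_distance \<Omega> (\<lambda>z. ln (F z)) x y"
    unfolding null_distance_eq using null_sums_nonempty[OF add_causal assms(2,3)]
    by (rule cInf_greatest) (auto dest: null_sum_ge)
  also have "\<dots> \<le> markowitz_distance \<Omega> x y"
    using null_le_markowitz[of 1 "\<lambda>z. ln (F z)" x y] log_bound assms(2,3) by simp
  finally show ?thesis .
qed

lemma null_distance_ltau:
  assumes "x \<in> \<Omega>" "v \<in> causal_cone"
  shows "null_distance \<Omega> ltau x (x + v) = ltau (x + v) - ltau x"
  using null_distance_causal[of x \<Omega> "x + v" ltau] assms add_causal ltau_mono[OF assms] by simp

end

section \<open>The equality cases\<close>

context future_convex_domain
begin

lemma past_timelike:
  assumes "x \<in> \<Omega>"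
  obtains e where "e > 0" "x - e *\<^sub>R time_vector \<in> \<Omega>"
proof -
  have "time_vector \<noteq> (0 :: 'n minkowski)" by (simp add: time_vector_def zero_prod_def)
  then obtain h0 where "h0 > 0" "\<And>s. s < h0 \<Longrightarrow> x - s *\<^sub>R time_vector \<in> \<Omega>"
    using past_exit[OF assms chron_cone_subset_causal_cone[OF time_vector_in_chron_cone]] by blast
  then show thesis using that[of "h0 / 2"] by simp
qed

text \<open>One geodesic bounds the squared ratio of \<open>tau\<close> at \<open>x + v\<close> and
  \<open>x\<close> by \<open>(1 + h0) / h0\<close>, while the distance to \<open>r\<close> bounds it
  below by \<open>(q + 2 * k) / q\<close>. So the ray exits no later than where it meets the light
  cone of \<open>r\<close>.\<close>

lemma exit_parameter_le:
  assumes eq: "\<And>y. y \<in> \<Omega> \<Longrightarrow> markowitz_distance \<Omega> x y = 2 * null_distance \<Omega> ltau x y"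
    and x: "x \<in> \<Omega>" and v: "v \<in> light_cone" "v \<noteq> 0"
    and r: "r \<in> closure \<Omega>" "x - r \<in> chron_cone" "lorentz_norm (x - r) = tau x"
    and h0: "h0 > 0" "\<And>s. s < h0 \<Longrightarrow> x - s *\<^sub>R v \<in> \<Omega>"
  shows "2 * h0 * - mink (x - r) v \<le> - mink (x - r) (x - r)"
proof -
  define q k where "q = - mink (x - r) (x - r)" and "k = - mink (x - r) v"
  have vc: "v \<in> causal_cone" using v(1) by (rule light_cone_subset_causal_cone)
  have q: "q > 0" using chron_cone_mink_neg[OF r(2)] by (simp add: q_def)
  have y: "x + v \<in> \<Omega>" by (rule add_causal[OF x vc])
  have c: "x + v - r \<in> chron_cone" using chron_cone_add[OF r(2) vc] by (simp add: algebra_simps)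
  have tx: "(tau x)\<^sup>2 = q"
    using lorentz_norm_sq[OF chron_cone_subset_causal_cone[OF r(2)]] r(3) by (simp add: q_def)
  have "x + v - r = (x - r) + 1 *\<^sub>R v" by simp
  then have "mink (x + v - r) (x + v - r) = - (q + 2 * k)"
    using light_cone_mink[OF v(1)] by (simp only: mink_add_self) (simp add: q_def k_def)
  then have "(lorentz_norm (x + v - r))\<^sup>2 = q + 2 * k"
    using lorentz_norm_sq[OF chron_cone_subset_causal_cone[OF c]] by simp
  moreover have "(lorentz_norm (x + v - r))\<^sup>2 \<le> (tau (x + v))\<^sup>2"
    using lorentz_norm_le_tau_closure[OF y r(1) chron_cone_subset_causal_cone[OF c]]
    by (intro power_mono) auto
  ultimately have ty: "q + 2 * k \<le> (tau (x + v))\<^sup>2" by simp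
  have "2 * (ltau (x + v) - ltau x) = markowitz_distance \<Omega> x (x + v)"
    using eq[OF y] null_distance_ltau[OF x vc] by simp
  also have "\<dots> \<le> ln ((1 + h0) / h0)"
    using markowitz_segment(1)[OF v h0(1) zero_le_one h0(2)] markowitz_distance_le by fastforce
  finally have "ln ((tau (x + v))\<^sup>2 / (tau x)\<^sup>2) \<le> ln ((1 + h0) / h0)"
    using tau_pos[OF x] tau_pos[OF y] by (simp add: ln_div ln_realpow)
  then have "(tau (x + v))\<^sup>2 / (tau x)\<^sup>2 \<le> (1 + h0) / h0"
    using tau_pos[OF x] tau_pos[OF y] h0(1) by (subst (asm) ln_le_cancel_iff) auto
  then have "(q + 2 * k) / q \<le> (1 + h0) / h0"
    using ty q unfolding tx by (meson divide_right_mono less_imp_le order_trans)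
  then have "2 * h0 * k \<le> q" using q h0(1) by (simp add: field_simps)
  then show ?thesis by (simp add: q_def k_def)
qed

lemma chronological_future_of_point_if_two_null:
  assumes eq: "\<And>x y. x \<in> \<Omega> \<Longrightarrow> y \<in> \<Omega> \<Longrightarrow> markowitz_distance \<Omega> x y = 2 * null_distance \<Omega> ltau x y"
  obtains p where "\<Omega> = chronological_future {p}"
proof -
  obtain x where x: "x \<in> \<Omega>" using domain_nonempty by blast
  obtain r where r: "r \<in> closure \<Omega>" "x - r \<in> chron_cone" "lorentz_norm (x - r) = tau x"
    by (rule tau_attained[OF x])
  have "y - r \<in> chron_cone" if y: "y \<in> \<Omega>" for y
  proof (rule chron_cone_of_light_cone)
    fix u :: "'n minkowski" assume u: "u \<in> light_cone" "u \<noteq> 0"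
    have uc: "u \<in> causal_cone" using u(1) by (rule light_cone_subset_causal_cone)
    define q m where "q = - mink (x - r) (x - r)" and "m = - mink (x - r) u"
    have q: "q > 0" using chron_cone_mink_neg[OF r(2)] by (simp add: q_def)
    have m: "m > 0" using mink_chron_neg[OF r(2) uc u(2)] by (simp add: m_def)
    \<comment> \<open>\<open>r + s u\<close> is where the light ray from \<open>r\<close> in direction \<open>u\<close> meets the past light cone of \<open>x\<close>;
      it lies outside the domain.\<close>
    define s where "s = q / (2 * m)"
    have s: "s > 0" using q m by (simp add: s_def)
    have sm: "2 * s * m = q" using m by (simp add: s_def)
    define v where "v = (x - r) - s *\<^sub>R u"
    have vv: "mink v v = 0"
      unfolding v_def mink_diff_self light_cone_mink[OF u(1)] using sm by (simp add: q_def m_def)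
    have "mink v u = - m" unfolding v_def m_def mink_algebra(2,5) light_cone_mink[OF u(1)] by simp
    then have v: "v \<in> light_cone" using m by (intro light_cone_of_mink[OF vv _ uc]) simp
    have v0: "v \<noteq> 0" using \<open>mink v u = - m\<close> m by (auto simp: mink_algebra)
    have kv: "mink (x - r) v = - q / 2"
      unfolding v_def mink_algebra(4)[of "x - r" "x - r"] mink_algebra(6) using sm
      by (simp add: q_def m_def)
    obtain h0 where h0: "h0 > 0" "x - h0 *\<^sub>R v \<notin> \<Omega>" "\<And>s. s < h0 \<Longrightarrow> x - s *\<^sub>R v \<in> \<Omega>"
      using past_exit[OF x light_cone_subset_causal_cone[OF v] v0] by blast
    \<comment> \<open>As \<open>mink (x - r) v\<close> is \<open>- q / 2\<close>, this says that the
      ray has left the domain at \<open>x - v\<close>, which is the point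
      \<open>r + s *\<^sub>R u\<close>.\<close>
    have "2 * h0 * - mink (x - r) v \<le> q"
      unfolding q_def by (rule exit_parameter_le[OF eq x v v0 r h0(1,3)]) (use x in auto)
    then have "h0 \<le> 1" using kv q by simp
    then have b: "x - 1 *\<^sub>R v \<notin> \<Omega>"
      using past_mono[OF h0(2) light_cone_subset_causal_cone[OF v]] by blast
    show "mink (y - r) u < 0"
    proof (rule ccontr)
      assume neg: "\<not> mink (y - r) u < 0"
      \<comment> \<open>Lowering \<open>y\<close> slightly in time makes the assumed sign
        strict.\<close>
      obtain \<epsilon> where \<epsilon>: "\<epsilon> > 0" "y - \<epsilon> *\<^sub>R time_vector \<in> \<Omega>" by (rule past_timelike[OF y])
      define w where "w = y - \<epsilon> *\<^sub>R time_vector - r"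
      define M where "M = mink w u"
      have "mink w u = mink (y - r) u - \<epsilon> * mink time_vector u"
        unfolding w_def by (simp add: mink_algebra)
      moreover have "mink time_vector u < 0" by (rule mink_chron_neg[OF time_vector_in_chron_cone uc u(2)])
      then have "\<epsilon> * mink time_vector u < 0" using \<epsilon>(1) by (simp add: mult_less_0_iff)
      ultimately have M: "M > 0" using neg by (simp add: M_def)
      \<comment> \<open>If \<open>mink (y - r) u\<close> were nonnegative, \<open>r + s u\<close> would lie in the chronological future of a
        point near \<open>r\<close> on the segment from \<open>r\<close> to \<open>y\<close>.\<close>
      define d where "d = min 1 (s * M / (\<bar>mink w w\<bar> + 1))"
      have d: "d > 0" "d \<le> 1" using s M by (auto simp: d_def add_nonneg_pos)
      have "d * (\<bar>mink w w\<bar> + 1) \<le> s * M"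
      proof -
        have "d \<le> s * M / (\<bar>mink w w\<bar> + 1)" by (simp add: d_def)
        moreover have "\<bar>mink w w\<bar> + 1 > 0" by (simp add: add_nonneg_pos)
        ultimately show ?thesis by (simp add: pos_le_divide_eq)
      qed
      moreover have "d * mink w w \<le> d * (\<bar>mink w w\<bar> + 1)" using d by (intro mult_left_mono) auto
      \<comment> \<open>The purpose of \<open>d\<close>: the quadratic term of
        \<open>mink k k\<close> is now at most \<open>d * s * M\<close>, half of what the mixed term
        subtracts.\<close>
      ultimately have dw: "d * mink w w \<le> s * M" by simp
      define k where "k = s *\<^sub>R u - d *\<^sub>R w"
      have "mink u w = M" unfolding M_def by (rule mink_commute)
      then have "mink k k = - 2 * d * s * M + d * (d * mink w w)"
        unfolding k_def mink_diff_self mink_algebra(5,6) light_cone_mink[OF u(1)]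
        by (simp only: power2_eq_square)
      moreover have "d * (d * mink w w) \<le> d * (s * M)" using dw d by (intro mult_left_mono) auto
      moreover have "d * (s * M) > 0" using d s M by simp
      ultimately have "mink k k < 0" by (simp add: mult.assoc)
      moreover have "mink k u < 0"
        unfolding k_def mink_algebra(2,5) light_cone_mink[OF u(1)] using d M by (simp add: M_def)
      ultimately have k: "k \<in> chron_cone" using chron_cone_of_mink uc by blast
      \<comment> \<open>This point is \<open>r + d *\<^sub>R w\<close>; adding \<open>k\<close>
        leads to the excluded point \<open>r + s *\<^sub>R u\<close>.\<close>
      have "(1 - d) *\<^sub>R r + d *\<^sub>R (y - \<epsilon> *\<^sub>R time_vector) \<in> closure \<Omega>"
        using d by (intro convexD_alt[OF convex_closure[OF convex_domain] r(1)
              subsetD[OF closure_subset \<epsilon>(2)]]) simp_all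
      then have "(1 - d) *\<^sub>R r + d *\<^sub>R (y - \<epsilon> *\<^sub>R time_vector) + k \<in> \<Omega>"
        by (rule closure_add_chron[OF _ k])
      moreover have "(1 - d) *\<^sub>R r + d *\<^sub>R (y - \<epsilon> *\<^sub>R time_vector) + k = x - 1 *\<^sub>R v"
        by (simp add: k_def w_def v_def algebra_simps)
      ultimately show False using b by simp
    qed
  qed
  moreover have "y \<in> \<Omega>" if "y - r \<in> chron_cone" for y
    using closure_add_chron[OF r(1) that] by simp
  ultimately have "\<Omega> = chronological_future {r}"
    unfolding chronological_future_eq by blast
  then show thesis by (rule that)
qed

text \<open>Here \<open>tau\<close> is the distance to \<open>p\<close>, so its square is affine
  along light rays and is itself a star function. Its logarithm is \<open>2 * ltau\<close>, which
  doubles the general lower bound.\<close>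

lemma two_null_if_chronological_future_of_point:
  assumes \<Omega>: "\<Omega> = chronological_future {p}" and xy: "x \<in> \<Omega>" "y \<in> \<Omega>"
  shows "markowitz_distance \<Omega> x y = 2 * null_distance \<Omega> ltau x y"
proof (rule antisym)
  show "markowitz_distance \<Omega> x y \<le> 2 * null_distance \<Omega> ltau x y"
    by (rule markowitz_le_two_null[OF xy])
  have \<Omega>_iff: "z \<in> \<Omega> \<longleftrightarrow> z - p \<in> chron_cone" for z
    unfolding \<Omega> chronological_future_eq by simp
  have p: "p \<in> closure \<Omega>"
    by (rule in_closure_of_ray[of p time_vector])
      (simp add: \<Omega>_iff chron_cone_scaleR time_vector_in_chron_cone)
  have tau: "tau z = lorentz_norm (z - p)" if z: "z \<in> \<Omega>" for z
  proof (rule antisym)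
    have c: "z - p \<in> causal_cone" using z \<Omega>_iff chron_cone_subset_causal_cone by blast
    show "lorentz_norm (z - p) \<le> tau z" by (rule lorentz_norm_le_tau_closure[OF z p c])
    show "tau z \<le> lorentz_norm (z - p)"
    proof (rule tau_le[OF z])
      fix y assume y: "y \<in> \<Omega>" "z - y \<in> causal_cone"
      then have "y - p \<in> causal_cone" using \<Omega>_iff chron_cone_subset_causal_cone by blast
      from lorentz_norm_mono[OF y(2) this] show "lorentz_norm (z - y) \<le> lorentz_norm (z - p)"
        by simp
    qed
  qed
  define F where "F z = - mink (z - p) (z - p)" for z
  have F_add: "F (z + c *\<^sub>R u) = F z + c * (- 2 * mink (z - p) u)" if "u \<in> light_cone" for z u c
    using mink_add_self[of "z - p" c u] light_cone_mink[OF that] by (simp add: F_def algebra_simps)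
  have F_pos: "F z > 0" if "z \<in> \<Omega>" for z
    using chron_cone_mink_neg[of "z - p"] that by (simp add: \<Omega>_iff F_def)
  have neg: "mink (z - p) u \<le> 0" if "z \<in> \<Omega>" "u \<in> light_cone" for z u
    using that by (intro mink_causal_nonpos)
      (auto simp: \<Omega>_iff intro: chron_cone_subset_causal_cone light_cone_subset_causal_cone)
  interpret F: lightlike_star_function \<Omega> F
  proof
    show "F z > 0" if "z \<in> \<Omega>" for z by (rule F_pos[OF that])
    show "F z \<le> F (z + u)" if "z \<in> \<Omega>" "u \<in> light_cone" for z u
      using F_add[OF that(2), of z 1] neg[OF that] by simp
    show "c * F (b + u) \<le> F (b + c *\<^sub>R u)"
      if "b \<in> \<Omega>" "u \<in> light_cone" "0 < c" "c \<le> 1" for b u c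
    proof -
      have "c * F b \<le> 1 * F b" using F_pos[OF that(1)] that(4) by (intro mult_right_mono) auto
      moreover define m where "m = - 2 * mink (b - p) u"
      have "F (b + u) = F b + m" using F_add[OF that(2), of b 1] by (simp add: m_def)
      moreover have "F (b + c *\<^sub>R u) = F b + c * m" unfolding m_def by (rule F_add[OF that(2)])
      ultimately show ?thesis by (simp add: distrib_left)
    qed
  qed
  have lnF: "ln (F z) = 2 * ltau z" if "z \<in> \<Omega>" for z
  proof -
    have "F z = (tau z)\<^sup>2"
      unfolding tau[OF that] F_def
      using lorentz_norm_sq[OF chron_cone_subset_causal_cone[OF \<Omega>_iff[THEN iffD1, OF that]]] by simp
    then show ?thesis using tau_pos[OF that] by (simp add: ln_realpow)
  qed
  show "2 * null_distance \<Omega> ltau x y \<le> markowitz_distance \<Omega> x y"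
  proof (rule null_le_markowitz[OF _ _ xy])
    fix \<gamma> :: "real \<Rightarrow> 'n minkowski" and s t :: real
    assume g: "projective_lightlike_geodesic \<Omega> \<gamma>" "s \<in> {-1<..<1}" "t \<in> {-1<..<1}"
    show "2 * \<bar>ltau (\<gamma> t) - ltau (\<gamma> s)\<bar> \<le> rho_I s t"
      using F.log_bound[OF g] lnF[OF geodesic_in_domain[OF g(1) g(2)]]
        lnF[OF geodesic_in_domain[OF g(1) g(3)]] by (simp add: abs_if split: if_splits)
  qed simp
qed

end

text \<open>Flipping the spatial part of a Euclidean normal \<open>a\<close> turns it into a
  Lorentzian one. If that were not timelike, the hyperplane would contain a direction that is not
  spacelike.\<close>

lemma spacelike_hyperplane_iff:
  fixes H :: "'n::finite minkowski set"
  shows "spacelike_hyperplane H \<longleftrightarrow>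
    (\<exists>p N. N \<in> chron_cone \<and> mink N N = -1 \<and> H = {y. mink (y - p) N = 0})"
proof
  assume sp: "spacelike_hyperplane H"
  then have "aff_dim H = int DIM('n minkowski) - 1" and affine: "affine hull H = H"
    by (simp_all add: spacelike_hyperplane_def affine_hull_eq)
  moreover have "int DIM('n minkowski) - 1 = int (DIM('n minkowski) - 1)"
    using DIM_positive[where 'a = "'n minkowski"] by linarith
  ultimately have "\<exists>a b. a \<noteq> 0 \<and> affine hull H = {x. a \<bullet> x = b}"
    using aff_dim_eq_hyperplane[of H] by (simp only:)
  then obtain a b where a: "a \<noteq> 0" and H: "H = {x. a \<bullet> x = b}"
    unfolding affine by (elim exE conjE)
  define p where "p = (b / (a \<bullet> a)) *\<^sub>R a"
  have p: "a \<bullet> p = b" using a by (simp add: p_def)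
  have pos: "mink v v > 0" if "a \<bullet> v = 0" "v \<noteq> 0" for v
  proof -
    have "v = (p + v) - p" "p \<in> H" "p + v \<in> H" using that p by (auto simp: H inner_add_right)
    then have "v \<in> {y - x |x y. x \<in> H \<and> y \<in> H}" by blast
    then show ?thesis using sp that(2) unfolding spacelike_hyperplane_def by blast
  qed
  have lt: "norm (snd a) < \<bar>fst a\<bar>"
  proof (rule ccontr)
    assume n: "\<not> norm (snd a) < \<bar>fst a\<bar>"
    then have a2: "snd a \<noteq> 0" using a by (auto simp: prod_eq_iff)
    \<comment> \<open>The vector orthogonal to \<open>a\<close> in the plane spanned by \<open>a\<close> and the time axis.\<close>
    define v where "v = ((norm (snd a))\<^sup>2, - fst a *\<^sub>R snd a)"
    have "a \<bullet> v = 0" by (simp add: v_def inner_prod_def power2_norm_eq_inner algebra_simps)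
    moreover have "v \<noteq> 0" using a2 by (simp add: v_def zero_prod_def)
    ultimately have "mink v v > 0" by (rule pos)
    moreover have "mink v v = (norm (snd a))\<^sup>2 * ((fst a)\<^sup>2 - (norm (snd a))\<^sup>2)"
      by (simp add: mink_self v_def power2_eq_square algebra_simps)
    ultimately have "(norm (snd a))\<^sup>2 < \<bar>fst a\<bar>\<^sup>2" using a2 by (simp add: zero_less_mult_iff)
    then have "norm (snd a) < \<bar>fst a\<bar>" by (rule power2_less_imp_less) simp
    then show False using n by simp
  qed
  \<comment> \<open>The sign makes the normal future directed.\<close>
  define M where "M = sgn (fst a) *\<^sub>R (fst a, - snd a)"
  have sgn: "sgn (fst a) \<noteq> 0" using lt by (auto simp: sgn_eq_0_iff)
  have M: "M \<in> chron_cone"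
    using lt sgn by (auto simp: M_def chron_cone_def sgn_if split: if_splits)
  have minkM: "mink y M = - sgn (fst a) * (a \<bullet> y)" for y
    by (simp add: M_def mink_def inner_prod_def inner_commute algebra_simps)
  define N where "N = (1 / lorentz_norm M) *\<^sub>R M"
  have "N \<in> chron_cone" using M lorentz_norm_pos[OF M] by (simp add: N_def chron_cone_scaleR)
  moreover have "mink N N = - 1" unfolding N_def by (rule mink_normalize[OF M])
  moreover have "mink (y - p) N = 0 \<longleftrightarrow> a \<bullet> y = b" for y
    using lorentz_norm_pos[OF M] sgn
    by (simp add: N_def mink_algebra(6) minkM inner_diff_right p)
  then have "H = {y. mink (y - p) N = 0}" by (simp add: H)
  ultimately show "\<exists>p N. N \<in> chron_cone \<and> mink N N = -1 \<and> H = {y. mink (y - p) N = 0}" by blast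
next
  assume "\<exists>p N. N \<in> chron_cone \<and> mink N N = -1 \<and> H = {y. mink (y - p) N = 0}"
  then obtain p N where N: "N \<in> chron_cone" and H: "H = {y. mink (y - p) N = 0}" by blast
  define a where "a = (- fst N, snd N)"
  have mink_a: "mink y N = a \<bullet> y" for y
    by (simp add: a_def mink_def inner_prod_def inner_commute)
  have a: "a \<noteq> 0" using N by (auto simp: a_def chron_cone_def zero_prod_def)
  have H': "H = {y. a \<bullet> y = a \<bullet> p}" by (simp add: H mink_a inner_diff_right)
  have "mink v v > 0" if v: "v \<in> {y - x |x y. x \<in> H \<and> y \<in> H}" "v \<noteq> 0" for v
  proof -
    obtain x y where "v = y - x" "x \<in> H" "y \<in> H" using v(1) by blast
    then have "mink v N = 0" by (simp add: mink_a H' inner_diff_right)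
    then show ?thesis using mink_pos_of_orthogonal_chron[OF N] v(2) by blast
  qed
  then show "spacelike_hyperplane H"
    unfolding spacelike_hyperplane_def using aff_dim_hyperplane[OF a, of "a \<bullet> p"] affine_hyperplane
    by (auto simp: H')
qed

lemma chronological_future_hyperplane:
  assumes N: "N \<in> chron_cone" "mink N N = -1"
  shows "chronological_future {y. mink (y - p) N = 0} = {y. mink (y - p) N < 0}"
proof (intro equalityI subsetI)
  fix y assume "y \<in> chronological_future {y. mink (y - p) N = 0}"
  then obtain x where x: "mink (x - p) N = 0" "y - x \<in> chron_cone"
    unfolding chronological_future_eq by blast
  have "N \<noteq> 0" using N(2) by (auto simp: mink_algebra)
  then have "mink (y - x) N < 0"
    using mink_chron_neg[OF x(2) chron_cone_subset_causal_cone[OF N(1)]] by blast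
  then show "y \<in> {y. mink (y - p) N < 0}" using x(1) by (simp add: mink_algebra)
next
  fix y assume "y \<in> {y. mink (y - p) N < 0}"
  then have h: "- mink (y - p) N > 0" by simp
  define x where "x = y - (- mink (y - p) N) *\<^sub>R N"
  have "mink (x - p) N = 0" using N(2) by (simp add: x_def mink_algebra)
  moreover have "y - x \<in> chron_cone" using chron_cone_scaleR[OF N(1) h] by (simp add: x_def)
  ultimately show "y \<in> chronological_future {y. mink (y - p) N = 0}"
    unfolding chronological_future_eq by blast
qed

section \<open>Equal distances and futures of spacelike hyperplanes\<close>

context future_convex_domain
begin

text \<open>Here \<open>tau\<close> is the height above the hyperplane: reverse Cauchy-Schwarz
  bounds it above, the orthogonal foot below. The height is affine along a light ray and vanishes at
  its past end, so one geodesic realises the increment of \<open>ltau\<close>.\<close>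

lemma null_if_chronological_future_of_hyperplane:
  assumes H: "spacelike_hyperplane H" and \<Omega>: "\<Omega> = chronological_future H"
    and xy: "x \<in> \<Omega>" "y \<in> \<Omega>"
  shows "null_distance \<Omega> ltau x y = markowitz_distance \<Omega> x y"
proof (rule antisym)
  show "null_distance \<Omega> ltau x y \<le> markowitz_distance \<Omega> x y"
    by (rule null_le_markowitz_ltau[OF xy])
  obtain p N where N: "N \<in> chron_cone" "mink N N = -1" and H_eq: "H = {y. mink (y - p) N = 0}"
    using H unfolding spacelike_hyperplane_iff by blast
  have \<Omega>_iff: "z \<in> \<Omega> \<longleftrightarrow> - mink (z - p) N > 0" for z
    unfolding \<Omega> H_eq chronological_future_hyperplane[OF N] by simp
  have tau: "tau z = - mink (z - p) N" if z: "z \<in> \<Omega>" for z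
  proof (rule antisym)
    define h where "h = - mink (z - p) N"
    have h: "h > 0" using z \<Omega>_iff by (simp add: h_def)
    have "z - h *\<^sub>R N \<in> closure \<Omega>"
      by (rule in_closure_of_ray[of _ N]) (use N in \<open>simp add: \<Omega>_iff mink_algebra h_def\<close>)
    moreover have c: "h *\<^sub>R N \<in> causal_cone"
      using chron_cone_scaleR[OF N(1) h] by (rule chron_cone_subset_causal_cone)
    ultimately have "lorentz_norm (h *\<^sub>R N) \<le> tau z"
      using lorentz_norm_le_tau_closure[OF z, of "z - h *\<^sub>R N"] by simp
    moreover have "lorentz_norm N = 1" using N(2) by (simp add: lorentz_norm_def)
    ultimately show "- mink (z - p) N \<le> tau z"
      using h by (simp add: lorentz_norm_scaleR flip: h_def)
    show "tau z \<le> - mink (z - p) N"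
    proof (rule tau_le[OF z])
      fix y assume y: "y \<in> \<Omega>" "z - y \<in> causal_cone"
      have "lorentz_norm (z - y) \<le> - mink (z - y) N" by (rule reverse_cauchy_schwarz(1)[OF N y(2)])
      also have "\<dots> = - mink (z - p) N + mink (y - p) N" by (simp add: mink_algebra)
      also have "\<dots> \<le> - mink (z - p) N" using y(1) \<Omega>_iff by simp
      finally show "lorentz_norm (z - y) \<le> - mink (z - p) N" .
    qed
  qed
  have light: "ltau (x + u) - ltau x \<in> markowitz_sums \<Omega> x (x + u) \<inter> markowitz_sums \<Omega> (x + u) x"
    if x: "x \<in> \<Omega>" and u: "u \<in> light_cone" "u \<noteq> 0" for x u
  proof -
    have uc: "u \<in> causal_cone" using u(1) by (rule light_cone_subset_causal_cone)
    define h k where "h = - mink (x - p) N" and "k = - mink u N"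
    have h: "h > 0" using x \<Omega>_iff by (simp add: h_def)
    have k: "k > 0" using mink_chron_neg[OF N(1) uc u(2)] by (simp add: k_def mink_commute)
    \<comment> \<open>At \<open>s = h / k\<close> the height \<open>h - s * k\<close> reaches
      zero.\<close>
    have past: "x - s *\<^sub>R u \<in> \<Omega>" if "s < h / k" for s
    proof -
      have "- mink (x - s *\<^sub>R u - p) N = h - s * k" by (simp add: h_def k_def mink_algebra)
      then show ?thesis using that k by (simp add: \<Omega>_iff pos_less_divide_eq)
    qed
    have "tau (x + u) = h + k"
      unfolding tau[OF add_causal[OF x uc]] by (simp add: h_def k_def mink_algebra)
    then have "ltau (x + u) - ltau x = ln ((h + k) / h)"
      using tau[OF x, folded h_def] h k by (simp add: ln_div)
    also have "(h + k) / h = (1 + h / k) / (h / k)" using h k by (simp add: field_simps)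
    finally have eq: "ltau (x + u) - ltau x = ln ((1 + h / k) / (h / k))" .
    have "0 < h / k" using h k by simp
    from markowitz_segment[OF u this zero_le_one past] show ?thesis
      unfolding eq by (simp only: scaleR_one Int_iff)
  qed
  have "markowitz_distance \<Omega> x y \<le> 1 * null_distance \<Omega> ltau x y"
  proof (rule markowitz_le_null(2)[OF zero_less_one _ xy])
    fix x v :: "'n minkowski" assume xv: "x \<in> \<Omega>" "v \<in> causal_cone"
    have "ltau (x + v) - ltau x \<in> markowitz_sums \<Omega> x (x + v) \<inter> markowitz_sums \<Omega> (x + v) x"
      using light subset_refl add_causal[OF _ light_cone_subset_causal_cone] xv
      by (rule markowitz_causal_le)
    then show "markowitz_distance \<Omega> x (x + v) \<le> 1 * (ltau (x + v) - ltau x) \<and>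
        markowitz_distance \<Omega> (x + v) x \<le> 1 * (ltau (x + v) - ltau x)"
      by (simp add: markowitz_distance_le)
  qed
  then show "markowitz_distance \<Omega> x y \<le> null_distance \<Omega> ltau x y" by simp
qed

text \<open>A functional separating \<open>b\<close> from the domain is nonnegative on causal
  directions, because the domain contains full future rays. Being affine and positive at the base
  point, it satisfies the star inequality.\<close>

lemma supporting_function:
  assumes b: "b \<notin> \<Omega>"
  obtains a where "lightlike_star_function \<Omega> (\<lambda>y. a \<bullet> (y - b))"
proof -
  obtain a c where a: "a \<noteq> 0" "a \<bullet> b \<le> c" "\<And>y. y \<in> \<Omega> \<Longrightarrow> c \<le> a \<bullet> y"
    using separating_hyperplane_sets[of "{b}" \<Omega>] convex_domain domain_nonempty b by auto
  have pos: "0 < a \<bullet> (y - b)" if y: "y \<in> \<Omega>" for y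
  proof -
    have "open ((\<lambda>e. y - e *\<^sub>R a) -` \<Omega>)"
      by (rule open_vimage[OF open_domain]) (intro continuous_intros)
    moreover have "0 \<in> (\<lambda>e. y - e *\<^sub>R a) -` \<Omega>" using y by simp
    ultimately obtain e where e: "e > 0" "cball 0 e \<subseteq> (\<lambda>e. y - e *\<^sub>R a) -` \<Omega>"
      using open_contains_cball by blast
    then have "y - e *\<^sub>R a \<in> \<Omega>" by (auto dest: subsetD[where c = e])
    then have "c \<le> a \<bullet> (y - e *\<^sub>R a)" by (rule a(3))
    moreover have "0 < e * (a \<bullet> a)" using e(1) a(1) by simp
    ultimately show ?thesis using a(2) by (simp add: inner_diff_right)
  qed
  have nonneg: "0 \<le> a \<bullet> u" if u: "u \<in> causal_cone" for u
  proof (rule ccontr)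
    assume "\<not> 0 \<le> a \<bullet> u"
    then have n: "a \<bullet> u < 0" by simp
    obtain y where y: "y \<in> \<Omega>" using domain_nonempty by blast
    \<comment> \<open>Following \<open>u\<close> this far would bring the positive functional down
      to zero inside the domain.\<close>
    define s where "s = a \<bullet> (y - b) / - (a \<bullet> u)"
    have s: "s \<ge> 0" using pos[OF y] n unfolding s_def by (intro divide_nonneg_nonneg) auto
    have "0 < a \<bullet> (y + s *\<^sub>R u - b)" by (intro pos add_causal[OF y] causal_cone_scaleR[OF u s])
    also have "\<dots> = a \<bullet> (y - b) + s * (a \<bullet> u)" by (simp add: inner_simps)
    also have "\<dots> = 0" using n by (simp add: s_def)
    finally show False by simp
  qed
  show thesis
  proof (rule that, unfold_locales)
    show "0 < a \<bullet> (y - b)" if "y \<in> \<Omega>" for y by (rule pos[OF that])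
    show "a \<bullet> (y - b) \<le> a \<bullet> (y + u - b)" if "y \<in> \<Omega>" "u \<in> light_cone" for y u
      using nonneg[OF light_cone_subset_causal_cone[OF that(2)]] by (simp add: inner_simps)
    show "c * (a \<bullet> (z + u - b)) \<le> a \<bullet> (z + c *\<^sub>R u - b)"
      if "z \<in> \<Omega>" "0 < c" "c \<le> 1" for z u c
    proof -
      have "c * (a \<bullet> (z - b)) \<le> 1 * (a \<bullet> (z - b))"
        using pos[OF that(1)] that(3) by (intro mult_right_mono) auto
      then show ?thesis by (simp add: inner_simps algebra_simps)
    qed
  qed
qed

text \<open>Along the ray, a functional supporting at the past end is proportional to the affine
  distance from that end, so its logarithm matches the upper bound from a single geodesic.\<close>

lemma markowitz_light_ray:
  assumes x: "x \<in> \<Omega>" and u: "u \<in> light_cone" "u \<noteq> 0" and h: "0 \<le> h"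
    and h0: "h0 > 0" "x - h0 *\<^sub>R u \<notin> \<Omega>" "\<And>s. s < h0 \<Longrightarrow> x - s *\<^sub>R u \<in> \<Omega>"
  shows "markowitz_distance \<Omega> x (x + h *\<^sub>R u) = ln ((h + h0) / h0)"
proof (rule antisym)
  show "markowitz_distance \<Omega> x (x + h *\<^sub>R u) \<le> ln ((h + h0) / h0)"
    using markowitz_segment(1)[OF u h0(1) h h0(3)] by (intro markowitz_distance_le)
  obtain a where a: "lightlike_star_function \<Omega> (\<lambda>y. a \<bullet> (y - (x - h0 *\<^sub>R u)))"
    by (rule supporting_function[OF h0(2)])
  interpret lightlike_star_function \<Omega> "\<lambda>y. a \<bullet> (y - (x - h0 *\<^sub>R u))" by (rule a)
  have y: "x + h *\<^sub>R u \<in> \<Omega>"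
    by (intro add_causal[OF x] causal_cone_scaleR light_cone_subset_causal_cone u h)
  have Fx: "a \<bullet> (x - (x - h0 *\<^sub>R u)) = h0 * (a \<bullet> u)" by simp
  have Fy: "a \<bullet> (x + h *\<^sub>R u - (x - h0 *\<^sub>R u)) = (h + h0) * (a \<bullet> u)"
    by (simp add: inner_simps algebra_simps)
  have au: "a \<bullet> u > 0" using F_pos[OF x] h0(1) unfolding Fx by (simp add: zero_less_mult_iff)
  have "ln ((h + h0) / h0) = ln ((h + h0) * (a \<bullet> u)) - ln (h0 * (a \<bullet> u))"
    using au h h0(1) by (simp add: ln_div ln_mult)
  also have "\<dots> \<le> markowitz_distance \<Omega> x (x + h *\<^sub>R u)"
    using star_function_le_markowitz[OF a x y] unfolding Fx Fy by simp
  finally show "ln ((h + h0) / h0) \<le> markowitz_distance \<Omega> x (x + h *\<^sub>R u)" .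
qed

text \<open>First-order optimality of \<open>r\<close>: moving it slightly towards \<open>z\<close> cannot increase the
  Lorentzian distance to \<open>x\<close>.\<close>

lemma domain_in_half_space:
  assumes x: "x \<in> \<Omega>"
    and r: "r \<in> closure \<Omega>" "x - r \<in> chron_cone" "lorentz_norm (x - r) = tau x"
    and z: "z \<in> \<Omega>"
  shows "mink (z - r) (x - r) < 0"
proof -
  have le: "mink (z - r) (x - r) \<le> 0" if z: "z \<in> \<Omega>" for z
  proof (rule ccontr)
    assume "\<not> mink (z - r) (x - r) \<le> 0"
    then have m: "mink (z - r) (x - r) > 0" by simp
    define w where "w = z - r"
    have "((\<lambda>s. (x - r) - s *\<^sub>R w) \<longlongrightarrow> (x - r) - 0 *\<^sub>R w) (at_right 0)"
      by (intro tendsto_intros)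
    then have "\<forall>\<^sub>F s in at_right 0. (x - r) - s *\<^sub>R w \<in> chron_cone"
      using r(2) by (intro topological_tendstoD[OF _ open_chron_cone]) auto
    moreover have "((\<lambda>s. 2 * mink w (x - r) - s * mink w w) \<longlongrightarrow> 2 * mink w (x - r) - 0 * mink w w) (at_right 0)"
      by (intro tendsto_intros)
    then have "\<forall>\<^sub>F s in at_right 0. 2 * mink w (x - r) - s * mink w w > 0"
      by (rule order_tendstoD(1)) (use m in \<open>simp add: w_def\<close>)
    moreover have "\<forall>\<^sub>F s in at_right (0::real). s \<in> {0<..<1}"
      by (rule eventually_at_right_real) simp
    ultimately have "\<forall>\<^sub>F s in at_right (0::real). (x - r) - s *\<^sub>R w \<in> chron_cone \<and>
        2 * mink w (x - r) - s * mink w w > 0 \<and> s \<in> {0<..<1}"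
      by (intro eventually_conj)
    then obtain s where s: "(x - r) - s *\<^sub>R w \<in> chron_cone" "2 * mink w (x - r) - s * mink w w > 0"
      "0 < s" "s < 1"
      using eventually_happens[of _ "at_right (0::real)"] by (auto simp: trivial_limit_at_right_real)
    have "(1 - s) *\<^sub>R r + s *\<^sub>R z \<in> closure \<Omega>"
      using s(3,4) by (intro convexD_alt[OF convex_closure[OF convex_domain] r(1)
            subsetD[OF closure_subset z]]) simp_all
    moreover have eq: "x - ((1 - s) *\<^sub>R r + s *\<^sub>R z) = (x - r) - s *\<^sub>R w"
      by (simp add: w_def algebra_simps)
    ultimately have "lorentz_norm ((x - r) - s *\<^sub>R w) \<le> lorentz_norm (x - r)"
      using lorentz_norm_le_tau_closure[OF x, of "(1 - s) *\<^sub>R r + s *\<^sub>R z"]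
        chron_cone_subset_causal_cone[OF s(1)] r(3) by (simp only:)
    then have "(lorentz_norm ((x - r) - s *\<^sub>R w))\<^sup>2 \<le> (lorentz_norm (x - r))\<^sup>2"
      by (intro power_mono) auto
    then have "s * (2 * mink w (x - r) - s * mink w w) \<le> 0"
      unfolding lorentz_norm_sq[OF chron_cone_subset_causal_cone[OF s(1)]]
        lorentz_norm_sq[OF chron_cone_subset_causal_cone[OF r(2)]] mink_diff_self
      by (simp add: mink_commute[of "x - r" w] power2_eq_square algebra_simps)
    then show False using mult_pos_pos[OF s(3,2)] by simp
  qed
  \<comment> \<open>The weak inequality at a point slightly below \<open>z\<close> in time gives the
    strict one at \<open>z\<close>.\<close>
  obtain e where e: "e > 0" "z - e *\<^sub>R time_vector \<in> \<Omega>" by (rule past_timelike[OF z])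
  have "mink time_vector (x - r) < 0"
    using r(2) by (intro mink_chron_neg time_vector_in_chron_cone chron_cone_subset_causal_cone)
      (auto simp: chron_cone_def)
  then have "e * mink time_vector (x - r) < 0" using e(1) by (simp add: mult_less_0_iff)
  then show ?thesis using le[OF e(2)] by (simp add: mink_algebra(1,2,5) algebra_simps)
qed

text \<open>The bound \<open>tau \<le> ht\<close> holds on the whole domain. Equality holds at
  \<open>x0\<close> and persists under future lightlike steps, hence spreads over the causal future
  of \<open>x0\<close>, which lies above every point of the hyperplane if one moves far enough along
  \<open>N\<close>.\<close>

lemma hyperplane_if_null:
  assumes eq: "\<And>x y. x \<in> \<Omega> \<Longrightarrow> y \<in> \<Omega> \<Longrightarrow> null_distance \<Omega> ltau x y = markowitz_distance \<Omega> x y"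
  obtains H where "spacelike_hyperplane H" "\<Omega> = chronological_future H"
proof -
  have tau_ray: "tau (x + h *\<^sub>R u) = tau x * (h + h0) / h0"
    if x: "x \<in> \<Omega>" and u: "u \<in> light_cone" "u \<noteq> 0" and h: "0 \<le> h"
      and h0: "h0 > 0" "x - h0 *\<^sub>R u \<notin> \<Omega>" "\<And>s. s < h0 \<Longrightarrow> x - s *\<^sub>R u \<in> \<Omega>" for x u h h0
  proof -
    have hu: "h *\<^sub>R u \<in> causal_cone"
      by (intro causal_cone_scaleR light_cone_subset_causal_cone u h)
    have y: "x + h *\<^sub>R u \<in> \<Omega>" by (rule add_causal[OF x hu])
    have "ltau (x + h *\<^sub>R u) - ltau x = ln ((h + h0) / h0)"
      using markowitz_light_ray[OF x u h h0] null_distance_ltau[OF x hu] eq[OF x y] by simp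
    then have "ln (tau (x + h *\<^sub>R u) / tau x) = ln ((h + h0) / h0)"
      using tau_pos[OF x] tau_pos[OF y] by (simp add: ln_div)
    then have "tau (x + h *\<^sub>R u) / tau x = (h + h0) / h0"
      using tau_pos[OF x] tau_pos[OF y] h h0(1) by (subst (asm) ln_inj_iff) auto
    then show ?thesis using tau_pos[OF x] by (simp add: field_simps)
  qed
  obtain x0 where x0: "x0 \<in> \<Omega>" using domain_nonempty by blast
  obtain r0 where r0: "r0 \<in> closure \<Omega>" "x0 - r0 \<in> chron_cone" "lorentz_norm (x0 - r0) = tau x0"
    by (rule tau_attained[OF x0])
  \<comment> \<open>The unit normal of the hyperplane to be found; \<open>ht\<close> will be the
    signed height above it.\<close>
  define N where "N = (1 / tau x0) *\<^sub>R (x0 - r0)"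
  have t0: "tau x0 > 0" by (rule tau_pos[OF x0])
  have N1: "N \<in> chron_cone" using r0(2) t0 by (simp add: N_def chron_cone_scaleR)
  have N2: "mink N N = -1"
    using mink_normalize[OF r0(2)] by (simp add: N_def r0(3))
  have N0: "N \<noteq> 0" using N2 by (auto simp: mink_algebra)
  have Nc: "N \<in> causal_cone" using N1 by (rule chron_cone_subset_causal_cone)
  define ht where "ht y = - mink (y - r0) N" for y
  have ht_diff: "ht y - ht z = - mink (y - z) N" for y z by (simp add: ht_def mink_algebra)
  have ht_add: "ht (y + v) = ht y - mink v N" for y v by (simp add: ht_def mink_algebra)
  have ht_pos: "ht y > 0" if "y \<in> \<Omega>" for y
    using domain_in_half_space[OF x0 r0 that] t0
    by (simp add: ht_def N_def mink_algebra(6) divide_less_0_iff)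
  have ht_closure: "ht y \<ge> 0" if "y \<in> closure \<Omega>" for y
  proof -
    have "closed {y. 0 \<le> ht y}"
      unfolding ht_def by (intro closed_Collect_le continuous_intros)
    moreover have "\<Omega> \<subseteq> {y. 0 \<le> ht y}" using ht_pos by (auto intro: less_imp_le)
    ultimately show ?thesis using closure_minimal that by blast
  qed
  have tau_le_ht: "tau y \<le> ht y" if y: "y \<in> \<Omega>" for y
  proof (rule tau_le[OF y])
    fix z assume z: "z \<in> \<Omega>" "y - z \<in> causal_cone"
    have "lorentz_norm (y - z) \<le> - mink (y - z) N" by (rule reverse_cauchy_schwarz(1)[OF N1 N2 z(2)])
    then show "lorentz_norm (y - z) \<le> ht y" using ht_diff[of y z] ht_pos[OF z(1)] by simp
  qed
  \<comment> \<open>If \<open>r\<close> realises \<open>tau x\<close>, then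
    \<open>tau x \<le> ht x - ht r \<le> ht x\<close>, so \<open>tau x = ht x\<close> forces
    equality in reverse Cauchy-Schwarz and \<open>r\<close> is the orthogonal foot.\<close>
  have foot: "x - tau x *\<^sub>R N \<in> closure \<Omega>" if x: "x \<in> \<Omega>" "tau x = ht x" for x
  proof -
    obtain r where r: "r \<in> closure \<Omega>" "x - r \<in> chron_cone" "lorentz_norm (x - r) = tau x"
      by (rule tau_attained[OF x(1)])
    have c: "x - r \<in> causal_cone" using r(2) by (rule chron_cone_subset_causal_cone)
    have "lorentz_norm (x - r) = - mink (x - r) N"
      using reverse_cauchy_schwarz(1)[OF N1 N2 c] ht_diff[of x r] ht_closure[OF r(1)] r(3) x(2) by simp
    then have "x - r = tau x *\<^sub>R N" using reverse_cauchy_schwarz(2)[OF N1 N2 c] r(3) by simp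
    then show ?thesis using r(1) by (metis diff_diff_eq2 add_diff_cancel_left')
  qed
  \<comment> \<open>\<open>tau\<close> is affine along the light ray and bounds the Lorentzian distance to the foot of \<open>x\<close>
    from above, with equality at \<open>x\<close>; hence its slope is at least that of \<open>ht\<close>.\<close>
  have light: "x + u \<in> \<Omega> \<and> tau (x + u) = ht (x + u)"
    if x: "x \<in> \<Omega>" "tau x = ht x" and u: "u \<in> light_cone" for x u
  proof (cases "u = 0")
    case False
    have uc: "u \<in> causal_cone" using u by (rule light_cone_subset_causal_cone)
    obtain h0 where h0: "h0 > 0" "x - h0 *\<^sub>R u \<notin> \<Omega>" "\<And>s. s < h0 \<Longrightarrow> x - s *\<^sub>R u \<in> \<Omega>"
      using past_exit[OF x(1) uc False] by blast
    define k T where "k = - mink N u" and "T = tau x"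
    have T: "T > 0" unfolding T_def by (rule tau_pos[OF x(1)])
    have k: "k > 0" using mink_chron_neg[OF N1 uc False] by (simp add: k_def)
    have ray: "tau (x + h *\<^sub>R u) = T * (h + h0) / h0" if "0 \<le> h" for h
      unfolding T_def by (rule tau_ray[OF x(1) u False that h0])
    \<comment> \<open>Squares are compared: \<open>T\<^sup>2 + 2 * h * T * k\<close> is the squared
      distance to the foot, and the square of the affine \<open>tau\<close> bounds it. Dividing by
      \<open>h * T\<close> and letting \<open>h\<close> tend to 0 leaves
      \<open>k \<le> T / h0\<close>.\<close>
    have bound: "2 * k \<le> 2 * T / h0 + h * (T / h0\<^sup>2)" if h: "h > 0" for h
    proof -
      define r where "r = x - T *\<^sub>R N"
      have r: "r \<in> closure \<Omega>" unfolding r_def T_def by (rule foot[OF x])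
      have hu: "h *\<^sub>R u \<in> causal_cone" using uc h by (simp add: causal_cone_scaleR)
      have y: "x + h *\<^sub>R u \<in> \<Omega>" by (rule add_causal[OF x(1) hu])
      have eq: "x + h *\<^sub>R u - r = T *\<^sub>R N + h *\<^sub>R u" by (simp add: r_def)
      have c: "T *\<^sub>R N + h *\<^sub>R u \<in> causal_cone"
        using causal_cone_add[OF causal_cone_scaleR[OF Nc] hu, of T] T by simp
      have "mink (T *\<^sub>R N + h *\<^sub>R u) (T *\<^sub>R N + h *\<^sub>R u) = - (T\<^sup>2 + 2 * h * T * k)"
        unfolding mink_add_self light_cone_mink[OF u] mink_algebra(5,6) N2
        by (simp add: k_def power2_eq_square)
      then have "T\<^sup>2 + 2 * h * T * k = (lorentz_norm (x + h *\<^sub>R u - r))\<^sup>2"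
        unfolding eq lorentz_norm_sq[OF c] by simp
      also have "\<dots> \<le> (tau (x + h *\<^sub>R u))\<^sup>2"
        using lorentz_norm_le_tau_closure[OF y r] c unfolding eq by (intro power_mono) auto
      also have "\<dots> = (T * (h + h0) / h0)\<^sup>2" using ray h by simp
      also have "\<dots> = T\<^sup>2 + h * T * (2 * T / h0 + h * (T / h0\<^sup>2))"
        using h0(1) by (simp add: power2_eq_square field_simps)
      finally have "(h * T) * (2 * k) \<le> (h * T) * (2 * T / h0 + h * (T / h0\<^sup>2))" by (simp add: mult_ac)
      then show ?thesis using h T by simp
    qed
    have "((\<lambda>h. 2 * T / h0 + h * (T / h0\<^sup>2)) \<longlongrightarrow> 2 * T / h0 + 0 * (T / h0\<^sup>2)) (at_right 0)"
      by (intro tendsto_intros)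
    moreover have "\<forall>\<^sub>F h in at_right 0. 2 * k \<le> 2 * T / h0 + h * (T / h0\<^sup>2)"
      using bound by (auto simp: eventually_at_right_field intro!: exI[of _ 1])
    ultimately have "2 * k \<le> 2 * T / h0 + 0 * (T / h0\<^sup>2)"
      by (rule tendsto_lowerbound) (simp add: trivial_limit_at_right_real)
    then have "T + k \<le> T + T / h0" by simp
    also have "\<dots> = tau (x + u)" using ray[of 1] h0(1) by (simp add: field_simps)
    finally have "ht (x + u) \<le> tau (x + u)"
      using x(2) by (simp add: ht_add k_def T_def mink_commute[of u N])
    then show ?thesis using tau_le_ht add_causal[OF x(1) uc] by (intro conjI antisym) auto
  qed (use x in simp)
  have tau_eq_ht: "x0 + v \<in> \<Omega> \<and> tau (x0 + v) = ht (x0 + v)" if v: "v \<in> causal_cone" for v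
  proof -
    have "x0 - r0 = tau x0 *\<^sub>R N" using t0 by (simp add: N_def)
    then have "tau x0 = ht x0" by (simp add: ht_def mink_algebra(5) N2)
    moreover obtain u w where "u \<in> light_cone" "w \<in> light_cone" "v = u + w"
      using lightlike_decomposition[OF v] by blast
    ultimately show ?thesis using light[of x0 u] light[of "x0 + u" w] x0 by (simp add: add.assoc)
  qed
  have "z \<in> \<Omega>" if z: "ht z > 0" for z
  proof -
    \<comment> \<open>The orthogonal projection of \<open>z\<close> on the hyperplane. Far above it
      along \<open>N\<close> lies a point of the causal future of \<open>x0\<close> with the same
      foot \<open>p\<close>.\<close>
    define p where "p = z - ht z *\<^sub>R N"
    obtain s where s: "s > 0" "p - x0 + s *\<^sub>R N \<in> chron_cone"
      using chron_cone_absorbs[OF N1, of "p - x0"] by blast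
    have y: "p + s *\<^sub>R N \<in> \<Omega>" "tau (p + s *\<^sub>R N) = ht (p + s *\<^sub>R N)"
      using tau_eq_ht[OF chron_cone_subset_causal_cone[OF s(2)]] by (auto simp: algebra_simps)
    have "ht (p + s *\<^sub>R N) = s"
      unfolding p_def using N2 by (simp add: ht_def mink_algebra algebra_simps)
    then have "p \<in> closure \<Omega>" using foot[OF y] y(2) by simp
    then have "p + ht z *\<^sub>R N \<in> \<Omega>" by (rule closure_add_chron[OF _ chron_cone_scaleR[OF N1 z]])
    then show ?thesis by (simp add: p_def)
  qed
  then have "\<Omega> = {y. mink (y - r0) N < 0}" using ht_pos by (force simp: ht_def)
  then have "\<Omega> = chronological_future {y. mink (y - r0) N = 0}"
    by (simp add: chronological_future_hyperplane[OF N1 N2])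
  moreover have "spacelike_hyperplane {y. mink (y - r0) N = 0}"
    unfolding spacelike_hyperplane_iff using N1 N2 by blast
  ultimately show thesis using that by blast
qed

end

theorem theorem6p6:
  fixes \<Omega> :: "'n::finite minkowski set"
  assumes "minkowski_domain \<Omega>"
    and "convex \<Omega>"
    and "future_complete \<Omega>"
    and "\<not> (\<exists>L. lightlike_line L \<and> L \<subseteq> \<Omega>)"
  shows "(\<forall>x\<in>\<Omega>. \<forall>y\<in>\<Omega>.
            null_distance \<Omega> (\<lambda>z. ln (cosmological_time \<Omega> z)) x y \<le> markowitz_distance \<Omega> x y \<and>
            markowitz_distance \<Omega> x y \<le> 2 * null_distance \<Omega> (\<lambda>z. ln (cosmological_time \<Omega> z)) x y) \<and>
         ((\<forall>x\<in>\<Omega>. \<forall>y\<in>\<Omega>.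
            null_distance \<Omega> (\<lambda>z. ln (cosmological_time \<Omega> z)) x y = markowitz_distance \<Omega> x y) \<longleftrightarrow>
          (\<exists>H. spacelike_hyperplane H \<and> \<Omega> = chronological_future H)) \<and>
         ((\<forall>x\<in>\<Omega>. \<forall>y\<in>\<Omega>.
            markowitz_distance \<Omega> x y = 2 * null_distance \<Omega> (\<lambda>z. ln (cosmological_time \<Omega> z)) x y) \<longleftrightarrow>
          (\<exists>p. \<Omega> = chronological_future {p}))"
proof -
  interpret future_convex_domain \<Omega>
  proof
    show "open \<Omega>" "convex \<Omega>" "\<Omega> \<noteq> {}" "\<Omega> \<noteq> UNIV"
      using assms(1,2) by (auto simp: minkowski_domain_def)
    show "x + v \<in> \<Omega>" if "x \<in> \<Omega>" "v \<in> causal_cone" for x v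
      by (rule future_complete_add[OF assms(3) that])
    show "\<exists>s. x + s *\<^sub>R v \<notin> \<Omega>" if "lightlike v" for x v
      using assms(4) that unfolding lightlike_line_def by blast
  qed
  have hyperplane: "(\<forall>x\<in>\<Omega>. \<forall>y\<in>\<Omega>. null_distance \<Omega> ltau x y = markowitz_distance \<Omega> x y) \<longleftrightarrow>
      (\<exists>H. spacelike_hyperplane H \<and> \<Omega> = chronological_future H)"
    using hyperplane_if_null null_if_chronological_future_of_hyperplane by metis
  have point: "(\<forall>x\<in>\<Omega>. \<forall>y\<in>\<Omega>. markowitz_distance \<Omega> x y = 2 * null_distance \<Omega> ltau x y) \<longleftrightarrow>
      (\<exists>p. \<Omega> = chronological_future {p})"
    using chronological_future_of_point_if_two_null two_null_if_chronological_future_of_point by metis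
  show ?thesis
    using hyperplane point null_le_markowitz_ltau markowitz_le_two_null by blast
qed

end
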